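(* Let $G$ be a finite graph on $n$ sites with maximum vertex-degree $\Delta$, let $\Theta=\{\Theta_k\}_{k=1,\dots,m}$ be any ordered set of edges of $G$ that covers $V$, and let $\mathcal{M}_{\mathrm{edge}}$ be the edge scan Markov chain on proper $q$-colourings of $G$ with transition matrix $\prod_{k=1}^m P^{[k]}$, where $P^{[k]}$ performs a heat-bath move on the endpoints of the edge $\Theta_k$. If $q\ge2\Delta$ then for every $\varepsilon\in(0,1)$, $$\mathrm{Mix}(\mathcal{M}_{\mathrm{edge}},\varepsilon)\le\Delta^2\log(n\varepsilon^{-1}).$$
   Context: $G=(V,E)$ with $V=\{1,\dots,n\}$; $C=\{1,\dots,q\}$ is the set of colours. The state space is the set $\Omega$ of proper $q$-colourings of $G$ (no two adjacent sites have the same colour) and $\pi$ is the uniform distribution on $\Omega$. A set of edges covers $V$ if every site is an endpoint of at least one of the edges. Heat-bath move on $\Theta_k$ from a configuration $x$: draw a new configuration uniformly at random from the set of configurations that agree with $x$ on $V\setminus\Theta_k$ and in which no edge containing a site of $\Theta_k$ is monochromatic. Mixing time: for a chain $\mathcal{M}$ with transition matrix $P$ and stationary distribution $\pi$, $\mathrm{Mix}_x(\mathcal{M},\varepsilon)=\min\{t>0:\mathrm{d}_{\mathrm{TV}}(P^t(x,\cdot),\pi(\cdot))\le\varepsilon\}$ and $\mathrm{Mix}(\mathcal{M},\varepsilon)=\max_x\mathrm{Mix}_x(\mathcal{M},\varepsilon)$, the maximum being over all initial configurations, where $\mathrm{d}_{\mathrm{TV}}(\theta_1,\theta_2)=\frac12\sum_i|\theta_1(i)-\theta_2(i)|$.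 One step of the chain is one full scan (one application of $\prod_k P^{[k]}$).
   Formalization: The bound proved is max(1, Δ² log(n/ε)): since Mix ≥ 1 by definition, the stated bound fails for the single-edge graph (n=2, Δ=1) with ε > 2/e; in every other case the maximum equals Δ² log(n/ε). *)

theory Defs
  imports "HOL-Probability.Probability"
begin

section \<open>Graphs and colourings\<close>

definition simple_graph :: "nat \<Rightarrow> nat set set \<Rightarrow> bool" where
  "simple_graph n E \<longleftrightarrow> (\<forall>e\<in>E. e \<subseteq> {1..n} \<and> card e = 2)"

definition degree :: "nat set set \<Rightarrow> nat \<Rightarrow> nat" where
  "degree E v = card {e \<in> E. v \<in> e}"

definition max_degree :: "nat \<Rightarrow> nat set set \<Rightarrow> nat" where
  "max_degree n E = Max (degree E ` {1..n})"

definition monochromatic :: "(nat \<Rightarrow> nat) \<Rightarrow> nat set \<Rightarrow> bool" where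
  "monochromatic x e \<longleftrightarrow> (\<exists>c. \<forall>v\<in>e. x v = c)"

text \<open>All assignments of colours to sites, proper or not. They are extensional functions,
  so that a configuration is determined by its values on the sites.\<close>

definition configurations :: "nat \<Rightarrow> nat \<Rightarrow> (nat \<Rightarrow> nat) set" where
  "configurations n q = {1..n} \<rightarrow>\<^sub>E {1..q}"

definition proper_colourings :: "nat \<Rightarrow> nat set set \<Rightarrow> nat \<Rightarrow> (nat \<Rightarrow> nat) set" where
  "proper_colourings n E q = {x \<in> configurations n q. \<forall>e\<in>E. \<not> monochromatic x e}"


section \<open>Markov chains\<close>

text \<open>A transition matrix is given by its rows, \<open>P x y = pmf (K x) y\<close>. The matrix product
  \<open>P\<^sub>1 P\<^sub>2\<close> is then Kleisli composition, with the move of \<open>P\<^sub>1\<close> made first.\<close>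

definition kernel_comp :: "('s \<Rightarrow> 's pmf) \<Rightarrow> ('s \<Rightarrow> 's pmf) \<Rightarrow> 's \<Rightarrow> 's pmf" where
  "kernel_comp K L = (\<lambda>x. bind_pmf (K x) L)"

definition kernel_prod :: "('s \<Rightarrow> 's pmf) list \<Rightarrow> 's \<Rightarrow> 's pmf" where
  "kernel_prod Ks = foldr kernel_comp Ks return_pmf"

definition kernel_power :: "('s \<Rightarrow> 's pmf) \<Rightarrow> nat \<Rightarrow> 's \<Rightarrow> 's pmf" where
  "kernel_power K t = kernel_prod (replicate t K)"

definition tv_dist :: "'s set \<Rightarrow> 's pmf \<Rightarrow> 's pmf \<Rightarrow> real" where
  "tv_dist \<Omega> \<mu> \<nu> = (1/2) * (\<Sum>i\<in>\<Omega>. \<bar>pmf \<mu> i - pmf \<nu> i\<bar>)"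

text \<open>Mixing times are extended naturals: if the distance to \<open>\<pi>\<close> never drops to \<open>\<epsilon>\<close>, then
  the set below is empty and its infimum is \<open>\<infinity>\<close>. Otherwise the infimum is the minimum, and it
  is at least 1.\<close>

definition mixing_time_from ::
    "'s set \<Rightarrow> ('s \<Rightarrow> 's pmf) \<Rightarrow> 's pmf \<Rightarrow> 's \<Rightarrow> real \<Rightarrow> enat" where
  "mixing_time_from \<Omega> K \<pi> x \<epsilon> = Inf {enat t | t. t > 0 \<and> tv_dist \<Omega> (kernel_power K t x) \<pi> \<le> \<epsilon>}"

definition mixing_time :: "'s set \<Rightarrow> ('s \<Rightarrow> 's pmf) \<Rightarrow> 's pmf \<Rightarrow> real \<Rightarrow> enat" where
  "mixing_time \<Omega> K \<pi> \<epsilon> = (SUP x\<in>\<Omega>. mixing_time_from \<Omega> K \<pi> x \<epsilon>)"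


section \<open>The edge scan chain\<close>

text \<open>If \<open>x\<close> is a proper colouring, then \<open>heat_bath_choices n E q S x\<close> contains \<open>x\<close> and consists
  of proper colourings, so a heat-bath move is well defined on proper colourings and stays
  among them. For other \<open>x\<close> the set may be empty and the move is unspecified.\<close>

definition heat_bath_choices ::
    "nat \<Rightarrow> nat set set \<Rightarrow> nat \<Rightarrow> nat set \<Rightarrow> (nat \<Rightarrow> nat) \<Rightarrow> (nat \<Rightarrow> nat) set" where
  "heat_bath_choices n E q S x =
     {y \<in> configurations n q. (\<forall>i\<in>{1..n} - S. y i = x i) \<and>
        (\<forall>e\<in>E. e \<inter> S \<noteq> {} \<longrightarrow> \<not> monochromatic y e)}"

definition heat_bath ::
    "nat \<Rightarrow> nat set set \<Rightarrow> nat \<Rightarrow> nat set \<Rightarrow> (nat \<Rightarrow> nat) \<Rightarrow> (nat \<Rightarrow> nat) pmf" where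
  "heat_bath n E q S x = pmf_of_set (heat_bath_choices n E q S x)"

definition edge_scan ::
    "nat \<Rightarrow> nat set set \<Rightarrow> nat \<Rightarrow> nat set list \<Rightarrow> (nat \<Rightarrow> nat) \<Rightarrow> (nat \<Rightarrow> nat) pmf" where
  "edge_scan n E q \<Theta> = kernel_prod (map (heat_bath n E q) \<Theta>)"

end

theory Submission
  imports Defs
begin

text \<open>
  The argument is Dobrushin's, in dual form. For a test function \<open>f\<close> let \<open>d\<^sub>i\<close> bound the change of
  \<open>f\<close> when only site \<open>i\<close> is recoloured. A heat-bath move on an edge \<open>{j, k}\<close> replaces \<open>d\<close> by
  \<open>d'\<close>, where \<open>d'\<^sub>j = d'\<^sub>k = 0\<close> and every other \<open>d'\<^sub>i\<close> exceeds \<open>d\<^sub>i\<close> by \<open>d\<^sub>j/s + d\<^sub>k/s\<^sup>2\<close> if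
  \<open>i\<close> is adjacent to \<open>j\<close>, and by \<open>d\<^sub>k/s + d\<^sub>j/s\<^sup>2\<close> if it is adjacent to \<open>k\<close>, with \<open>s = q - \<Delta>\<close>:
  recolouring \<open>i\<close> exchanges at most one of the colours available at the endpoint. Each of the
  coefficients of \<open>d\<^sub>j\<close> and \<open>d\<^sub>k\<close> in the sum of the \<open>d'\<^sub>i\<close> is at most
  \<open>\<alpha> = (\<Delta> - 1)(1/s + 1/s\<^sup>2) \<le> 1 - 1/\<Delta>\<^sup>2\<close>, so a scan that covers all sites contracts the sum
  of the \<open>d\<^sub>i\<close> by \<open>\<alpha>\<close>.

  The mixing time is an integer, so \<open>t\<close> scans must suffice as soon as \<open>t + 1 > \<Delta>\<^sup>2 ln (n/\<epsilon>)\<close>, and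
  one more factor \<open>1 - 1/\<Delta>\<^sup>2\<close> is needed. For \<open>q = 2\<Delta>\<close> it comes from the start: a uniformly random
  proper colouring differs from a given one at a given site with probability at most
  \<open>1 - 1/q \<le> 1 - 1/\<Delta>\<^sup>2\<close> (if \<open>\<Delta> \<ge> 2\<close>; for \<open>\<Delta> = 1\<close>, \<open>\<alpha> = 0\<close>). For \<open>q > 2\<Delta>\<close>, even
  \<open>\<alpha> \<le> (1 - 1/\<Delta>\<^sup>2)\<^sup>2\<close>.
\<close>

section \<open>Random pairs of distinct colours\<close>

lemma frac_le_cross:
  fixes a b c d :: real
  assumes "a * d \<le> c * b" "b > 0" "d > 0"
  shows "a / b \<le> c / d"
  using assms by (simp add: field_simps)

lemma abs_sum_bound:
  fixes f :: "'a \<Rightarrow> real"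
  assumes "\<And>x. x \<in> S \<Longrightarrow> \<bar>f x\<bar> \<le> K"
  shows "\<bar>sum f S\<bar> \<le> real (card S) * K"
  using order_trans[OF sum_abs sum_bounded_above, of S f K] assms by auto

text \<open>The mean of \<open>F a b\<close> over a uniformly random pair of distinct colours
  \<open>a\<close> in \<open>A\<close> and \<open>b\<close> in \<open>B\<close>; it is 0 if there is
  no such pair.\<close>

definition pair_avg :: "('c \<Rightarrow> 'c \<Rightarrow> real) \<Rightarrow> 'c set \<Rightarrow> 'c set \<Rightarrow> real" where
  "pair_avg F A B = (\<Sum>a\<in>A. \<Sum>b\<in>B - {a}. F a b) / (\<Sum>a\<in>A. real (card (B - {a})))"

lemma pair_avg_commute:
  assumes "finite A" "finite B"
  shows "pair_avg (\<lambda>b a. F a b) B A = pair_avg F A B"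
proof -
  have swap: "(\<Sum>b\<in>B. \<Sum>a\<in>A - {b}. G a b) = (\<Sum>a\<in>A. \<Sum>b\<in>B - {a}. G a b)" for G :: "'a \<Rightarrow> 'a \<Rightarrow> real"
  proof -
    have "A - {b} = {a \<in> A. a \<noteq> b}" "B - {b} = {a \<in> B. b \<noteq> a}" for b by auto
    then show ?thesis
      using sum.swap_restrict[OF assms, of G "(\<noteq>)"] by simp
  qed
  show ?thesis
    using swap[of F] swap[of "\<lambda>_ _. 1"] by (simp add: pair_avg_def)
qed

section \<open>Changing one colour of the first set\<close>

text \<open>\<open>B\<close> holds the colours available at one endpoint of the edge and stays
  fixed, while the set for the other endpoint varies within \<open>C\<close>; \<open>d1\<close> and
  \<open>d2\<close> bound the dependence of \<open>F\<close> on its first and second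
  argument.\<close>

locale two_spin =
  fixes F :: "'c \<Rightarrow> 'c \<Rightarrow> real" and C B :: "'c set" and d1 d2 :: real
  assumes finC: "finite C" and BC: "B \<subseteq> C"
    and d1: "\<And>a a' b. \<lbrakk>a \<in> C; a' \<in> C; b \<in> C\<rbrakk> \<Longrightarrow> \<bar>F a b - F a' b\<bar> \<le> d1"
    and d2: "\<And>a b b'. \<lbrakk>a \<in> C; b \<in> C; b' \<in> C\<rbrakk> \<Longrightarrow> \<bar>F a b - F a b'\<bar> \<le> d2"
    and d_nonneg: "d1 \<ge> 0" "d2 \<ge> 0"
begin

text \<open>\<open>row a / wt a\<close> is the conditional mean of \<open>F\<close> given the first
  colour \<open>a\<close>. The two are kept apart because \<open>wt a\<close> may be 0.\<close>

definition row :: "'c \<Rightarrow> real" where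
  "row a = (\<Sum>b\<in>B - {a}. F a b)"

definition wt :: "'c \<Rightarrow> real" where
  "wt a = real (card (B - {a}))"

abbreviation avg :: "'c set \<Rightarrow> real" where
  "avg A \<equiv> pair_avg F A B"

lemma avg_def: "avg A = sum row A / sum wt A"
  by (simp add: pair_avg_def row_def wt_def)

lemma finB: "finite B"
  using finC BC finite_subset by blast

lemma wt_nonneg: "wt a \<ge> 0"
  by (simp add: wt_def)

lemma wt_eq: "wt a = real (card B) - of_bool (a \<in> B)"
proof (cases "a \<in> B")
  case True
  then have "card B \<ge> 1"
    using finB by (metis One_nat_def Suc_leI card_gt_0_iff empty_iff)
  then show ?thesis
    using True finB by (simp add: wt_def card_Diff_singleton of_nat_diff)
qed (simp add: wt_def)

lemma d12:
  assumes "a \<in> C" "a' \<in> C" "b \<in> C" "b' \<in> C"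
  shows "\<bar>F a b - F a' b'\<bar> \<le> d1 + d2"
  using d1[of a a' b] d2[of a' b b'] assms by linarith

lemma row_split:
  assumes "a \<noteq> c"
  shows "row a = (\<Sum>b\<in>B - {a, c}. F a b) + of_bool (c \<in> B) * F a c"
proof (cases "c \<in> B")
  case True
  then have "B - {a} = insert c (B - {a, c})" using assms by auto
  then show ?thesis using True finB by (simp add: row_def)
next
  case False
  then have "B - {a} = B - {a, c}" by auto
  then show ?thesis using False by (simp add: row_def)
qed

text \<open>Cleared of denominators: the conditional means given \<open>c\<close> and given
  \<open>a\<close> differ by at most \<open>d1 + d2 / wt c\<close>. The second colours in
  \<open>B - {a, c}\<close> occur on both sides and are matched at cost \<open>d1\<close>; only the
  colours \<open>a\<close> and \<open>c\<close> themselves bring in \<open>d2\<close>.\<close>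

lemma row_cross_diff:
  assumes "a \<in> C" "c \<in> C"
  shows "\<bar>wt a * row c - wt c * row a\<bar> \<le> wt a * (wt c * d1 + d2)"
proof (cases "a = c")
  case True
  then show ?thesis using d_nonneg wt_nonneg by simp
next
  case False
  define h where "h z = (\<Sum>b\<in>B - {a, c}. F z b)" for z
  define k where "k = real (card (B - {a, c}))"
  have k0: "k \<ge> 0" by (simp add: k_def)
  have rowc: "row c = h c + of_bool (a \<in> B) * F c a"
    using row_split[of c a] False by (auto simp: h_def insert_commute)
  have rowa: "row a = h a + of_bool (c \<in> B) * F a c"
    using row_split[of a c] False by (auto simp: h_def)
  have card_split: "card (B - {z}) = card (B - {a, c}) + of_bool (z' \<in> B)"
    if "{z, z'} = {a, c}" "z \<noteq> z'" for z z'
  proof -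
    have "B - {z} - {z'} = B - {a, c}" using that by auto
    then show ?thesis
      using card_Suc_Diff1[of "B - {z}" z'] finB that by (cases "z' \<in> B") auto
  qed
  have wta: "wt a = k + of_bool (c \<in> B)" and wtc: "wt c = k + of_bool (a \<in> B)"
    unfolding wt_def k_def
    by (subst card_split, use False in auto)+
  have hd: "\<bar>h c - h a\<bar> \<le> k * d1"
    unfolding h_def k_def sum_subtractf[symmetric]
    by (rule abs_sum_bound) (intro d1, use assms BC in auto)
  have hc: "\<bar>h c - k * F a c\<bar> \<le> k * (d1 + d2)"
  proof -
    have "h c - k * F a c = (\<Sum>b\<in>B - {a, c}. F c b - F a c)"
      by (simp add: h_def k_def sum_subtractf)
    also have "\<bar>\<dots>\<bar> \<le> k * (d1 + d2)"
      unfolding k_def by (rule abs_sum_bound) (intro d12, use assms BC in auto)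
    finally show ?thesis .
  qed
  have ha: "\<bar>h a - k * F c a\<bar> \<le> k * (d1 + d2)"
  proof -
    have "h a - k * F c a = (\<Sum>b\<in>B - {a, c}. F a b - F c a)"
      by (simp add: h_def k_def sum_subtractf)
    also have "\<bar>\<dots>\<bar> \<le> k * (d1 + d2)"
      unfolding k_def by (rule abs_sum_bound) (intro d12, use assms BC in auto)
    finally show ?thesis .
  qed
  have khd: "\<bar>k * (h c - h a)\<bar> \<le> k * (k * d1)"
    using hd k0 by (simp add: abs_mult mult_left_mono)
  \<comment> \<open>If just one of \<open>a\<close>, \<open>c\<close> lies in \<open>B\<close>, one
    row has an unmatched term, which \<open>ha\<close> or \<open>hc\<close> compares with the
    \<open>k\<close> terms of the other row.\<close>
  consider "a \<in> B" "c \<in> B" | "a \<in> B" "c \<notin> B" | "a \<notin> B" "c \<in> B" | "a \<notin> B" "c \<notin> B"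
    by blast
  then show ?thesis
  proof cases
    case 1
    have "wt a * row c - wt c * row a = (k + 1) * ((h c - h a) + (F c a - F a c))"
      using 1 by (simp add: wta wtc rowa rowc algebra_simps)
    moreover have "\<bar>(h c - h a) + (F c a - F a c)\<bar> \<le> (k + 1) * d1 + d2"
      using hd d12[of c a a c] assms by (simp add: algebra_simps)
    ultimately show ?thesis
      using 1 k0 by (simp add: wta wtc abs_mult mult_left_mono)
  next
    case 2
    have "wt a * row c - wt c * row a = k * (h c - h a) - (h a - k * F c a)"
      using 2 by (simp add: wta wtc rowa rowc algebra_simps)
    moreover have "wt a * (wt c * d1 + d2) = k * (k * d1) + k * (d1 + d2)"
      using 2 by (simp add: wta wtc algebra_simps)
    ultimately show ?thesis using khd ha by linarith
  next
    case 3
    have "wt a * row c - wt c * row a = k * (h c - h a) + (h c - k * F a c)"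
      using 3 by (simp add: wta wtc rowa rowc algebra_simps)
    moreover have "wt a * (wt c * d1 + d2) = k * (k * d1) + k * (d1 + d2) + d2"
      using 3 k0 hd by (simp add: wta wtc algebra_simps) 
    ultimately show ?thesis using khd hc d_nonneg by linarith
  next
    case 4
    have "wt a * row c - wt c * row a = k * (h c - h a)"
      using 4 by (simp add: wta wtc rowa rowc algebra_simps)
    moreover have "wt a * (wt c * d1 + d2) = k * (k * d1) + k * d2"
      using 4 by (simp add: wta wtc algebra_simps)
    moreover have "k * d2 \<ge> 0" using k0 d_nonneg by simp
    ultimately show ?thesis using khd by linarith
  qed
qed

text \<open>The new average mixes the old one with the conditional mean at \<open>c\<close>, the
  latter with weight \<open>wt c / (sum wt A + wt c)\<close>. Summing \<open>row_cross_diff\<close>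
  over \<open>A\<close> bounds the gap between the two.\<close>

lemma avg_insert:
  assumes "A \<subseteq> C" "c \<in> C" "c \<notin> A" "sum wt A > 0"
  shows "(sum wt A + wt c) * \<bar>avg (insert c A) - avg A\<bar> \<le> wt c * d1 + d2"
proof -
  let ?N = "sum wt A"
  have finA: "finite A" using assms(1) finC finite_subset by blast
  have pos: "?N + wt c > 0" using assms(4) wt_nonneg[of c] by linarith
  have "(?N + wt c) * avg (insert c A) = sum row A + row c"
    using assms finA pos by (simp add: avg_def add.commute)
  moreover have "sum row A = ?N * avg A"
    using assms by (simp add: avg_def)
  moreover have "(\<Sum>a\<in>A. wt a * row c - wt c * row a) = ?N * row c - wt c * sum row A"
    by (simp add: sum_subtractf sum_distrib_left sum_distrib_right)
  ultimately have eq: "(?N + wt c) * (avg (insert c A) - avg A)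
      = (\<Sum>a\<in>A. wt a * row c - wt c * row a) / ?N"
    using assms by (simp add: field_simps)
  have "\<bar>\<Sum>a\<in>A. wt a * row c - wt c * row a\<bar> \<le> (\<Sum>a\<in>A. wt a * (wt c * d1 + d2))"
    by (rule order_trans[OF sum_abs sum_mono]) (use row_cross_diff assms in auto)
  also have "\<dots> = ?N * (wt c * d1 + d2)"
    by (simp add: sum_distrib_right)
  finally have "\<bar>(\<Sum>a\<in>A. wt a * row c - wt c * row a) / ?N\<bar> \<le> wt c * d1 + d2"
    using assms(4) by (simp add: field_simps)
  then show ?thesis
    using pos by (simp add: eq[symmetric] abs_mult)
qed

lemma avg_near:
  assumes "A \<subseteq> C" "c \<in> C" "b \<in> C" "sum wt A > 0"
  shows "\<bar>F c b - avg A\<bar> \<le> d1 + d2"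
proof -
  let ?N = "sum wt A"
  have "?N * F c b - sum row A = (\<Sum>a\<in>A. \<Sum>b'\<in>B - {a}. F c b - F a b')"
    by (simp add: row_def wt_def sum_subtractf sum_distrib_right)
  also have "\<bar>\<dots>\<bar> \<le> (\<Sum>a\<in>A. wt a * (d1 + d2))"
    unfolding wt_def
  proof (rule order_trans[OF sum_abs sum_mono], rule abs_sum_bound)
    show "\<bar>F c b - F a b'\<bar> \<le> d1 + d2" if "a \<in> A" "b' \<in> B - {a}" for a b'
      using that assms BC by (intro d12) auto
  qed
  also have "\<dots> = ?N * (d1 + d2)"
    by (simp add: sum_distrib_right)
  finally have "\<bar>?N * F c b - sum row A\<bar> \<le> ?N * (d1 + d2)" .
  moreover have "?N * F c b - sum row A = ?N * (F c b - avg A)"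
    using assms(4) by (simp add: avg_def field_simps)
  ultimately show ?thesis
    using assms(4) by (simp add: abs_mult)
qed

text \<open>An exchange obeys the same bound as the insertion of the heavier colour alone. For equal
  weights \<open>row_cross_diff\<close> compares the rows. Otherwise \<open>c\<close> is outside
  \<open>B\<close> and \<open>c'\<close> inside, so \<open>row c\<close> has one additional term
  \<open>F c c'\<close>, which is set against the average.\<close>

lemma avg_swap:
  assumes W: "W \<subseteq> C" and c: "c \<in> C" "c \<notin> W" and c': "c' \<in> C" "c' \<notin> W"
    and pos: "sum wt W > 0" and le: "wt c' \<le> wt c"
  shows "(sum wt W + wt c) * \<bar>avg (insert c W) - avg (insert c' W)\<bar> \<le> wt c * d1 + d2"
proof -
  let ?N = "sum wt W" and ?E = "avg (insert c' W)"
  have finW: "finite W" using W finC finite_subset by blast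
  have pos1: "?N + wt c > 0" "?N + wt c' > 0"
    using pos wt_nonneg[of c] wt_nonneg[of c'] by linarith+
  have "(?N + wt c) * avg (insert c W) = sum row W + row c"
    using c finW pos1 by (simp add: avg_def add.commute)
  moreover have "(?N + wt c') * ?E = sum row W + row c'"
    using c' finW pos1 by (simp add: avg_def add.commute)
  ultimately have eq: "(?N + wt c) * (avg (insert c W) - ?E) = row c - row c' - (wt c - wt c') * ?E"
    by (simp add: algebra_simps)
  have "\<bar>row c - row c' - (wt c - wt c') * ?E\<bar> \<le> wt c * d1 + d2"
  proof (cases "wt c = wt c'")
    case True
    \<comment> \<open>\<open>row_cross_diff\<close> carries a factor \<open>wt c\<close>, which
      cancels unless it is 0; in that case both rows are empty sums.\<close>
    show ?thesis
    proof (cases "wt c = 0")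
      case True
      then have "B - {c} = {}" "B - {c'} = {}"
        using \<open>wt c = wt c'\<close> finB unfolding wt_def
        by (metis card_0_eq finite_Diff of_nat_eq_0_iff)+
      then have "row c = 0" "row c' = 0"
        by (simp_all only: row_def sum.empty)
      then show ?thesis using True \<open>wt c = wt c'\<close> d_nonneg by simp
    next
      case False
      then have "wt c > 0" using wt_nonneg[of c] by simp
      moreover have "wt c * \<bar>row c - row c'\<bar> \<le> wt c * (wt c * d1 + d2)"
        using row_cross_diff[OF c'(1) c(1)] True wt_nonneg[of c]
        by (simp add: right_diff_distrib[symmetric] abs_mult)
      ultimately show ?thesis using True by simp
    qed
  next
    case False
    then have cB: "c \<notin> B" "c' \<in> B"
      using le by (auto simp: wt_eq split: if_splits)
    have ne: "c \<noteq> c'" using cB by auto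
    have wt1: "wt c = wt c' + 1" using cB by (simp add: wt_eq)
    have "row c = (\<Sum>b\<in>B - {c'}. F c b) + F c c'"
      using row_split[OF ne] cB by (simp add: Diff_insert0 insert_commute)
    then have "row c - row c' - (wt c - wt c') * ?E
        = (\<Sum>b\<in>B - {c'}. F c b - F c' b) + (F c c' - ?E)"
      by (simp add: row_def sum_subtractf wt1)
    moreover have "\<bar>\<Sum>b\<in>B - {c'}. F c b - F c' b\<bar> \<le> wt c' * d1"
      unfolding wt_def by (rule abs_sum_bound) (intro d1, use c c' BC in auto)
    moreover have "\<bar>F c c' - ?E\<bar> \<le> d1 + d2"
      by (rule avg_near) (use W c c' pos1 finW in auto)
    moreover have "wt c * d1 = wt c' * d1 + d1" by (simp add: wt1 algebra_simps)
    ultimately show ?thesis by linarith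
  qed
  then show ?thesis
    using pos1 by (simp add: eq[symmetric] abs_mult)
qed

text \<open>Every colour in \<open>W\<close> leaves at least \<open>card B - 1\<close> partners, so
  \<open>sum wt W \<ge> s * (card B - 1) \<ge> s^2\<close>, which yields the coefficient of
  \<open>d2\<close>. As \<open>wt c \<le> card B\<close>, also
  \<open>sum wt W + wt c \<ge> s * wt c\<close>, which yields that of \<open>d1\<close>.\<close>

lemma normalised_bound:
  assumes s: "s \<ge> 1" and B: "card B \<ge> s + 1" and W: "W \<subseteq> C" "card W \<ge> s"
    and le: "(sum wt W + wt c) * D \<le> wt c * d1 + d2" and D: "D \<ge> 0"
  shows "D \<le> d1 / real s + d2 / real s ^ 2" and "sum wt W > 0"
proof -
  let ?\<beta> = "real (card B)" and ?s = "real s"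
  have s1: "?s \<ge> 1" using s by simp
  have b1: "?\<beta> \<ge> ?s + 1" using B by linarith
  have "real (card W) * (?\<beta> - 1) \<le> sum wt W"
    by (rule sum_bounded_below) (simp add: wt_eq)
  moreover have "?s * (?\<beta> - 1) \<le> real (card W) * (?\<beta> - 1)"
    using W b1 s1 by (intro mult_right_mono) auto
  ultimately have N: "?s * (?\<beta> - 1) \<le> sum wt W" by linarith
  have "?s * ?s \<le> ?s * (?\<beta> - 1)"
    using b1 s1 by (intro mult_left_mono) auto
  then have N2: "?s * ?s \<le> sum wt W" using N by linarith
  moreover have "0 < ?s * ?s" using s1 by simp
  ultimately show pos: "sum wt W > 0" by linarith
  have w: "wt c \<le> ?\<beta>" by (simp add: wt_eq)
  have "(?s - 1) * wt c \<le> (?s - 1) * ?\<beta>" using w s1 by (intro mult_left_mono) auto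
  then have ws: "wt c * ?s \<le> sum wt W + wt c"
    using N b1 by (simp add: algebra_simps)
  have M: "sum wt W + wt c > 0" "?s * ?s \<le> sum wt W + wt c"
    using pos N2 wt_nonneg[of c] by linarith+
  have "D \<le> (wt c * d1 + d2) / (sum wt W + wt c)"
    using le M by (simp add: pos_le_divide_eq mult.commute)
  also have "\<dots> = wt c / (sum wt W + wt c) * d1 + 1 / (sum wt W + wt c) * d2"
    by (simp add: add_divide_distrib)
  also have "\<dots> \<le> 1 / ?s * d1 + 1 / (?s * ?s) * d2"
  proof (intro add_mono mult_right_mono d_nonneg)
    show "wt c / (sum wt W + wt c) \<le> 1 / ?s"
      using ws M s1 by (simp add: field_simps)
    show "1 / (sum wt W + wt c) \<le> 1 / (?s * ?s)"
      using M s1 by (intro divide_left_mono) auto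
  qed
  finally show "D \<le> d1 / ?s + d2 / ?s ^ 2" by (simp add: power2_eq_square)
qed

lemma avg_perturb:
  assumes s: "s \<ge> 1" and B: "card B \<ge> s + 1" and A: "A \<subseteq> C" "A' \<subseteq> C"
    and W: "card (A \<inter> A') \<ge> s" and d: "card (A - A') \<le> 1" "card (A' - A) \<le> 1"
  shows "\<bar>avg A - avg A'\<bar> \<le> d1 / real s + d2 / real s ^ 2"
proof -
  define W where "W = A \<inter> A'"
  have WC: "W \<subseteq> C" "card W \<ge> s" using A W by (auto simp: W_def)
  note norm = normalised_bound(1)[OF s B WC _ abs_ge_zero]
  \<comment> \<open>Positivity of the total weight does not involve the difference of averages, so
    it is obtained with \<open>D = 0\<close>.\<close>
  have "(sum wt W + wt c) * 0 \<le> wt c * d1 + d2" for c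
    using wt_nonneg[of c] d_nonneg by simp
  from normalised_bound(2)[OF s B WC this] have pos: "sum wt W > 0" by simp
  have fin: "finite (A - A')" "finite (A' - A)" using A finC finite_subset by blast+
  have small: "S = {} \<or> (\<exists>c. S = {c})" if "finite S" "card S \<le> 1" for S :: "'c set"
    using that card_1_singletonE by (cases "card S") auto
  have AW: "A = W \<union> (A - A')" "A' = W \<union> (A' - A)" by (auto simp: W_def)
  have nonneg: "0 \<le> d1 / real s + d2 / real s ^ 2" using d_nonneg by simp
  consider "A - A' = {}" "A' - A = {}" | c where "A - A' = {c}" "A' - A = {}"
    | c where "A - A' = {}" "A' - A = {c}" | c c' where "A - A' = {c}" "A' - A = {c'}"
    using small[OF fin(1) d(1)] small[OF fin(2) d(2)] by blast
  then show ?thesis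
  proof cases
    case 1
    then show ?thesis using AW nonneg by simp
  next
    case (2 c)
    then have c: "c \<in> C" "c \<notin> W" using A by (auto simp: W_def)
    have eq: "A = insert c W" "A' = W" using AW 2 by auto
    show ?thesis
      using norm[OF avg_insert[OF WC(1) c pos]] eq by simp
  next
    case (3 c)
    then have c: "c \<in> C" "c \<notin> W" using A by (auto simp: W_def)
    have eq: "A = W" "A' = insert c W" using AW 3 by auto
    show ?thesis
      using norm[OF avg_insert[OF WC(1) c pos]] eq by (simp add: abs_minus_commute)
  next
    case (4 c c')
    then have c: "c \<in> C" "c \<notin> W" and c': "c' \<in> C" "c' \<notin> W"
      using A by (auto simp: W_def)
    have eq: "A = insert c W" "A' = insert c' W" using AW 4 by auto
    \<comment> \<open>\<open>avg_swap\<close> wants the heavier colour first; the other order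
      follows by symmetry.\<close>
    show ?thesis
    proof (cases "wt c' \<le> wt c")
      case True
      then show ?thesis
        using norm[OF avg_swap[OF WC(1) c c' pos]] eq by simp
    next
      case False
      then have "wt c \<le> wt c'" by simp
      from norm[OF avg_swap[OF WC(1) c' c pos this]] show ?thesis
        using eq by (simp add: abs_minus_commute)
    qed
  qed
qed

end

lemma pair_avg_diff:
  assumes "finite A" "finite B" "K \<ge> 0"
    and "\<And>a b. a \<in> A \<Longrightarrow> b \<in> B \<Longrightarrow> \<bar>F a b - G a b\<bar> \<le> K"
  shows "\<bar>pair_avg F A B - pair_avg G A B\<bar> \<le> K"
proof -
  let ?N = "\<Sum>a\<in>A. real (card (B - {a}))"
  have N0: "?N \<ge> 0" by (intro sum_nonneg) auto
  have "pair_avg F A B - pair_avg G A B = (\<Sum>a\<in>A. \<Sum>b\<in>B - {a}. F a b - G a b) / ?N"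
    by (simp add: pair_avg_def sum_subtractf diff_divide_distrib)
  moreover have "\<bar>\<Sum>a\<in>A. \<Sum>b\<in>B - {a}. F a b - G a b\<bar> \<le> (\<Sum>a\<in>A. real (card (B - {a})) * K)"
  proof (rule order_trans[OF sum_abs sum_mono], rule abs_sum_bound)
    show "\<bar>F a b - G a b\<bar> \<le> K" if "a \<in> A" "b \<in> B - {a}" for a b
      using that by (intro assms(4)) auto
  qed
  then have "\<bar>\<Sum>a\<in>A. \<Sum>b\<in>B - {a}. F a b - G a b\<bar> \<le> K * ?N"
    by (simp add: sum_distrib_left mult.commute)
  then have "\<bar>\<Sum>a\<in>A. \<Sum>b\<in>B - {a}. F a b - G a b\<bar> / ?N \<le> K"
    using N0 assms(3) by (cases "?N = 0") (simp_all add: divide_le_eq)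
  ultimately show ?thesis
    using N0 by (simp add: abs_of_nonneg)
qed

section \<open>Test functions and their oscillation at each site\<close>

definition oscillation :: "nat \<Rightarrow> nat \<Rightarrow> ((nat \<Rightarrow> nat) \<Rightarrow> real) \<Rightarrow> (nat \<Rightarrow> real) \<Rightarrow> bool" where
  "oscillation n q f d \<longleftrightarrow> (\<forall>i\<in>{1..n}. \<forall>x\<in>configurations n q. \<forall>y\<in>configurations n q.
     (\<forall>v. v \<noteq> i \<longrightarrow> x v = y v) \<longrightarrow> \<bar>f x - f y\<bar> \<le> d i)"

lemma oscillationD:
  "\<lbrakk>oscillation n q f d; i \<in> {1..n}; x \<in> configurations n q; y \<in> configurations n q;
    \<And>v. v \<noteq> i \<Longrightarrow> x v = y v\<rbrakk> \<Longrightarrow> \<bar>f x - f y\<bar> \<le> d i"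
  unfolding oscillation_def by blast

lemma oscillation_cong:
  "(\<And>x. x \<in> configurations n q \<Longrightarrow> f x = g x) \<Longrightarrow> oscillation n q f d = oscillation n q g d"
  unfolding oscillation_def by simp

lemma finite_configurations: "finite (configurations n q)"
  unfolding configurations_def by (intro finite_PiE) auto

lemma configurations_upd:
  "\<lbrakk>x \<in> configurations n q; i \<in> {1..n}; c \<in> {1..q}\<rbrakk> \<Longrightarrow> x(i := c) \<in> configurations n q"
  by (auto simp: configurations_def PiE_iff extensional_def)

lemma configurations_range:
  "\<lbrakk>x \<in> configurations n q; i \<in> {1..n}\<rbrakk> \<Longrightarrow> x i \<in> {1..q}"
  by (auto simp: configurations_def PiE_iff)

lemma configurations_eqI:
  "\<lbrakk>x \<in> configurations n q; y \<in> configurations n q; \<And>i. i \<in> {1..n} \<Longrightarrow> x i = y i\<rbrakk> \<Longrightarrow> x = y"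
  unfolding configurations_def by (rule PiE_ext)

text \<open>The sites of disagreement are recoloured one by one, each at cost
  \<open>d i\<close>.\<close>

lemma oscillation_telescope:
  assumes f: "oscillation n q f d" and x: "x \<in> configurations n q" and y: "y \<in> configurations n q"
  shows "\<bar>f x - f y\<bar> \<le> (\<Sum>i\<in>{1..n}. of_bool (x i \<noteq> y i) * d i)"
proof -
  have *: "\<bar>f x - f y\<bar> \<le> sum d S"
    if "finite S" "S \<subseteq> {1..n}" "x \<in> configurations n q" "\<And>i. i \<in> {1..n} - S \<Longrightarrow> x i = y i" for S x
    using that
  proof (induction S arbitrary: x rule: finite_induct)
    case empty
    have "x = y" by (rule configurations_eqI[OF empty(2) y]) (use empty(3) in simp)
    then show ?case by simp
  next
    case (insert i S)
    let ?x = "x(i := y i)"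
    have x': "?x \<in> configurations n q"
      using insert.prems configurations_range[OF y] by (intro configurations_upd) auto
    have "\<bar>f x - f ?x\<bar> \<le> d i"
      by (rule oscillationD[OF f _ insert.prems(2) x']) (use insert.prems in auto)
    moreover have "\<bar>f ?x - f y\<bar> \<le> sum d S"
      by (rule insert.IH[OF _ x']) (use insert.prems in auto)
    ultimately have "\<bar>f x - f y\<bar> \<le> d i + sum d S" by linarith
    then show ?case using insert.hyps by simp
  qed
  have "\<bar>f x - f y\<bar> \<le> sum d {i \<in> {1..n}. x i \<noteq> y i}"
    by (rule *) (use x in auto)
  also have "\<dots> = (\<Sum>i\<in>{1..n}. of_bool (x i \<noteq> y i) * d i)"
    by (intro sum.mono_neutral_cong_left) auto
  finally show ?thesis .
qed

section \<open>Heat-bath moves on edges\<close>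

definition nbrs :: "nat set set \<Rightarrow> nat \<Rightarrow> nat set" where
  "nbrs E j = {u. {j, u} \<in> E}"

text \<open>The colours that the neighbours of \<open>j\<close> other than \<open>k\<close> permit
  at \<open>j\<close>. The site \<open>k\<close> is left out because it is recoloured in the same
  move.\<close>

definition avail :: "nat set set \<Rightarrow> nat \<Rightarrow> (nat \<Rightarrow> nat) \<Rightarrow> nat \<Rightarrow> nat \<Rightarrow> nat set" where
  "avail E q x j k = {1..q} - x ` (nbrs E j - {k})"

lemma monochromatic_pair: "monochromatic x {u, v} \<longleftrightarrow> x u = x v"
  by (auto simp: monochromatic_def)

locale scan_graph =
  fixes n q \<Delta> :: nat and E :: "nat set set"
  assumes simple: "simple_graph n E"
    and deg: "\<And>v. v \<in> {1..n} \<Longrightarrow> degree E v \<le> \<Delta>"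
    and \<Delta>: "\<Delta> \<ge> 1" and q: "q \<ge> 2 * \<Delta>"
begin

abbreviation "Conf \<equiv> configurations n q"
abbreviation "Col \<equiv> proper_colourings n E q"

definition s :: nat where "s = q - \<Delta>"

definition \<alpha> :: real where "\<alpha> = (real \<Delta> - 1) * (1 / real s + 1 / real s ^ 2)"

lemma s_ge: "s \<ge> \<Delta>" "s \<ge> 1"
  using q \<Delta> by (auto simp: s_def)

lemma edgeE:
  assumes "e \<in> E"
  obtains j k where "e = {j, k}" "j \<noteq> k" "j \<in> {1..n}" "k \<in> {1..n}"
proof -
  have "card e = 2" "e \<subseteq> {1..n}" using simple assms by (auto simp: simple_graph_def)
  then show ?thesis using that by (auto simp: card_2_iff)
qed

lemma edgeD:
  assumes "{j, k} \<in> E"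
  shows "j \<noteq> k" "j \<in> {1..n}" "k \<in> {1..n}"
proof -
  have "card {j, k} = 2" "{j, k} \<subseteq> {1..n}" using simple assms by (auto simp: simple_graph_def)
  then show "j \<noteq> k" "j \<in> {1..n}" "k \<in> {1..n}" by auto
qed

lemma finite_E: "finite E"
  by (rule finite_subset[of _ "Pow {1..n}"]) (use simple in \<open>auto simp: simple_graph_def\<close>)

lemma finite_nbrs: "finite (nbrs E j)"
  by (rule finite_subset[of _ "{1..n}"]) (use edgeD in \<open>auto simp: nbrs_def\<close>)

text \<open>The edge \<open>{j, k}\<close> is itself one of the at most \<Delta> edges at
  \<open>j\<close>.\<close>

lemma card_nbrs:
  assumes "{j, k} \<in> E"
  shows "card (nbrs E j - {k}) \<le> \<Delta> - 1"
proof -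
  have "card (nbrs E j - {k}) \<le> card ({e \<in> E. j \<in> e} - {{j, k}})"
  proof (rule card_inj_on_le)
    show "inj_on (\<lambda>u. {j, u}) (nbrs E j - {k})"
      by (auto simp: inj_on_def doubleton_eq_iff)
    show "(\<lambda>u. {j, u}) ` (nbrs E j - {k}) \<subseteq> {e \<in> E. j \<in> e} - {{j, k}}"
      by (auto simp: nbrs_def doubleton_eq_iff)
  qed (use finite_E in auto)
  also have "\<dots> = degree E j - 1"
    using assms by (subst card_Diff_singleton) (auto simp: degree_def)
  also have "\<dots> \<le> \<Delta> - 1"
    using deg edgeD[OF assms] by (intro diff_le_mono) auto
  finally show ?thesis .
qed

lemma card_avail:
  assumes "{j, k} \<in> E"
  shows "card (avail E q x j k) \<ge> s + 1"
proof -
  have "card (x ` (nbrs E j - {k})) \<le> \<Delta> - 1"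
    using card_nbrs[OF assms] card_image_le[of "nbrs E j - {k}" x] finite_nbrs by fastforce
  moreover have "card {1..q} - card (x ` (nbrs E j - {k})) \<le> card (avail E q x j k)"
    unfolding avail_def using finite_nbrs by (intro diff_card_le_card_Diff) auto
  ultimately show ?thesis using q \<Delta> by (simp add: s_def)
qed

text \<open>Since \<open>x\<close> and \<open>y\<close> agree off \<open>i\<close>, together they
  block at most one colour more than \<open>x\<close> alone, hence at most \<Delta> colours, and
  \<open>s = q - \<Delta>\<close> remain.\<close>

lemma card_avail_Int:
  assumes "{j, k} \<in> E" and eq: "\<And>v. v \<noteq> i \<Longrightarrow> x v = y v"
  shows "card (avail E q x j k \<inter> avail E q y j k) \<ge> s"
proof -
  let ?S = "nbrs E j - {k}"
  have sub: "x ` ?S \<union> y ` ?S \<subseteq> insert (y i) (x ` ?S)" using eq by force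
  have "card (x ` ?S \<union> y ` ?S) \<le> card (insert (y i) (x ` ?S))"
    using sub finite_nbrs by (intro card_mono) auto
  also have "\<dots> \<le> Suc (card (x ` ?S))"
    by (rule card_insert_le_m1) auto
  also have "card (x ` ?S) \<le> \<Delta> - 1"
    using card_nbrs[OF assms(1)] card_image_le[of ?S x] finite_nbrs by fastforce
  finally have le: "card (x ` ?S \<union> y ` ?S) \<le> \<Delta>" using \<Delta> by simp
  have "avail E q x j k \<inter> avail E q y j k = {1..q} - (x ` ?S \<union> y ` ?S)"
    by (auto simp: avail_def)
  moreover have "card {1..q} - card (x ` ?S \<union> y ` ?S) \<le> card ({1..q} - (x ` ?S \<union> y ` ?S))"
    using finite_nbrs by (intro diff_card_le_card_Diff) auto
  ultimately show ?thesis using le by (simp add: s_def)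
qed

lemma card_avail_Diff:
  assumes eq: "\<And>v. v \<noteq> i \<Longrightarrow> x v = y v"
  shows "card (avail E q x j k - avail E q y j k) \<le> 1"
proof -
  have "avail E q x j k - avail E q y j k \<subseteq> {y i}" using eq by (force simp: avail_def)
  from card_mono[OF _ this] show ?thesis by simp
qed

lemma avail_cong:
  assumes "\<And>v. v \<noteq> i \<Longrightarrow> x v = y v" "{i, j} \<notin> E \<or> i = k"
  shows "avail E q x j k = avail E q y j k"
proof -
  have "x ` (nbrs E j - {k}) = y ` (nbrs E j - {k})"
  proof (intro image_cong refl)
    fix u assume "u \<in> nbrs E j - {k}"
    then have "u \<noteq> i" using assms(2) by (auto simp: nbrs_def insert_commute)
    then show "x u = y u" by (rule assms(1))
  qed
  then show ?thesis by (simp add: avail_def)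
qed

section \<open>Edge moves as random pairs of distinct colours\<close>

text \<open>Edges from \<open>j\<close> or \<open>k\<close> to other sites amount to membership in
  \<open>avail\<close>, and the edge \<open>{j, k}\<close> demands distinct colours. Edges away from
  \<open>j\<close> and \<open>k\<close> impose nothing, so \<open>x\<close> may be improper.\<close>

lemma heat_bath_choices_edge:
  assumes e: "{j, k} \<in> E" and x: "x \<in> Conf"
  shows "heat_bath_choices n E q {j, k} x =
    (\<lambda>(a, b). x(j := a, k := b)) ` (SIGMA a:avail E q x j k. avail E q x k j - {a})"
    (is "?L = ?\<phi> ` ?R")
proof (intro equalityI subsetI)
  note jk = edgeD[OF e]
  fix y assume y: "y \<in> ?L"
  then have yC: "y \<in> Conf" and ag: "\<And>i. i \<in> {1..n} \<Longrightarrow> i \<noteq> j \<Longrightarrow> i \<noteq> k \<Longrightarrow> y i = x i"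
    and nm: "\<And>f. f \<in> E \<Longrightarrow> f \<inter> {j, k} \<noteq> {} \<Longrightarrow> \<not> monochromatic y f"
    by (auto simp: heat_bath_choices_def)
  have "y = x(j := y j, k := y k)"
    by (rule configurations_eqI[OF yC]) (use x yC jk ag configurations_upd configurations_range in auto)
  moreover have "y j \<noteq> y k" using nm[OF e] by (simp add: monochromatic_pair)
  moreover have "y j \<noteq> x u" if "u \<in> nbrs E j - {k}" for u
    using nm[of "{j, u}"] ag[of u] that edgeD[of j u] by (auto simp: nbrs_def monochromatic_pair)
  moreover have "y k \<noteq> x u" if "u \<in> nbrs E k - {j}" for u
    using nm[of "{k, u}"] ag[of u] that edgeD[of k u] by (auto simp: nbrs_def monochromatic_pair)
  moreover have "y j \<in> {1..q}" "y k \<in> {1..q}"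
    using configurations_range[OF yC] jk by blast+
  ultimately have "(y j, y k) \<in> ?R" "y = ?\<phi> (y j, y k)"
    by (auto simp: avail_def)
  then show "y \<in> ?\<phi> ` ?R" by blast
next
  note jk = edgeD[OF e]
  fix y assume "y \<in> ?\<phi> ` ?R"
  then obtain a b where y: "y = x(j := a, k := b)"
    and a: "a \<in> avail E q x j k" and b: "b \<in> avail E q x k j" "b \<noteq> a" by auto
  have "y \<in> Conf"
    using x jk a b unfolding y by (intro configurations_upd) (auto simp: avail_def)
  moreover have "\<not> monochromatic y f" if f: "f \<in> E" "f \<inter> {j, k} \<noteq> {}" for f
  proof -
    obtain u v where uv: "f = {u, v}" "u \<noteq> v" using edgeE[OF f(1)] by metis
    consider w where "f = {j, w}" "w \<noteq> j" | w where "f = {k, w}" "w \<noteq> k"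
      using uv f by auto
    then show ?thesis
    proof cases
      case (1 w)
      then have "w = k \<or> w \<in> nbrs E j - {k}" using f by (auto simp: nbrs_def)
      then show ?thesis using a b jk 1 by (auto simp: y monochromatic_pair avail_def)
    next
      case (2 w)
      then have "w = j \<or> w \<in> nbrs E k - {j}" using f by (auto simp: nbrs_def)
      then show ?thesis using a b jk 2 by (auto simp: y monochromatic_pair avail_def)
    qed
  qed
  ultimately show "y \<in> ?L" by (auto simp: heat_bath_choices_def y)
qed

lemma heat_bath_choices_finite: "finite (heat_bath_choices n E q S x)"
  unfolding heat_bath_choices_def using finite_configurations by auto

text \<open>Both endpoints have at least \<open>s + 1 \<ge> 2\<close> available colours, so two
  distinct ones can be chosen. The move is thus well defined on all of \<open>Conf\<close>, where
  the oscillation argument takes place.\<close>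

lemma heat_bath_choices_nonempty:
  assumes "e \<in> E" "x \<in> Conf"
  shows "heat_bath_choices n E q e x \<noteq> {}"
proof -
  obtain j k where e: "e = {j, k}" using edgeE[OF assms(1)] by metis
  have jk: "{j, k} \<in> E" "{k, j} \<in> E" using assms e by (auto simp: insert_commute)
  have "card (avail E q x j k) \<ge> 2" "card (avail E q x k j) \<ge> 2"
    using card_avail[OF jk(1), of x] card_avail[OF jk(2), of x] s_ge by linarith+
  then obtain a where a: "a \<in> avail E q x j k"
    by (metis card.empty equals0I not_numeral_le_zero)
  have "\<not> avail E q x k j \<subseteq> {a}"
    using card_mono[of "{a}" "avail E q x k j"] \<open>card (avail E q x k j) \<ge> 2\<close> by auto
  then show ?thesis
    unfolding e heat_bath_choices_edge[OF jk(1) assms(2)] using a by auto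
qed

lemma expectation_heat_bath:
  assumes "e \<in> E" "x \<in> Conf"
  shows "measure_pmf.expectation (heat_bath n E q e x) f =
    sum f (heat_bath_choices n E q e x) / card (heat_bath_choices n E q e x)"
  unfolding heat_bath_def
  using heat_bath_choices_finite heat_bath_choices_nonempty[OF assms] by (intro integral_pmf_of_set)

lemma expectation_heat_bath_pair_avg:
  assumes e: "{j, k} \<in> E" and x: "x \<in> Conf"
  shows "measure_pmf.expectation (heat_bath n E q {j, k} x) f =
    pair_avg (\<lambda>a b. f (x(j := a, k := b))) (avail E q x j k) (avail E q x k j)"
proof -
  let ?\<phi> = "\<lambda>(a, b). x(j := a, k := b)"
  let ?A = "avail E q x j k" and ?B = "avail E q x k j"
  let ?R = "SIGMA a:?A. ?B - {a}"
  have fin: "finite ?A" "finite ?B" by (auto simp: avail_def)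
  have val: "?\<phi> p j = fst p" "?\<phi> p k = snd p" for p
    using edgeD(1)[OF e] by (cases p; simp)+
  have inj: "inj_on ?\<phi> ?R"
  proof (rule inj_onI)
    fix p p' assume "?\<phi> p = ?\<phi> p'"
    then have "?\<phi> p j = ?\<phi> p' j" "?\<phi> p k = ?\<phi> p' k" by (rule fun_cong)+
    then show "p = p'" unfolding val by (rule prod_eqI)
  qed
  show ?thesis
    unfolding expectation_heat_bath[OF e x] heat_bath_choices_edge[OF e x] pair_avg_def
    unfolding sum.reindex[OF inj] card_image[OF inj]
    using fin by (simp add: sum.Sigma comp_def case_prod_unfold)
qed

text \<open>The coefficient of \<open>d j\<close> adds the direct effect of site \<open>i\<close> on
  \<open>j\<close>, of size \<open>1/s\<close>, and its effect through the other endpoint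
  \<open>k\<close>, of size \<open>1/s^2\<close>. The inner sum has the single index
  \<open>k\<close>; this form treats \<open>e\<close> as a set without ordering its
  endpoints.\<close>

definition influence :: "nat set \<Rightarrow> (nat \<Rightarrow> real) \<Rightarrow> nat \<Rightarrow> real" where
  "influence e d i = (if i \<in> e then 0 else d i + (\<Sum>j\<in>e.
     (of_bool ({i, j} \<in> E) / real s + (\<Sum>k\<in>e - {j}. of_bool ({i, k} \<in> E) / real s ^ 2)) * d j))"

lemma influence_pair:
  assumes "j \<noteq> k" "i \<notin> {j, k}"
  shows "influence {j, k} d i = d i
    + of_bool ({i, j} \<in> E) * (d j / real s + d k / real s ^ 2)
    + of_bool ({i, k} \<in> E) * (d k / real s + d j / real s ^ 2)"
proof -
  have "{j, k} - {j} = {k}" "{j, k} - {k} = {j}" using assms by auto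
  then show ?thesis using assms by (simp add: influence_def algebra_simps)
qed

lemma influence_nonneg:
  assumes "e \<in> E" "\<And>i. i \<in> {1..n} \<Longrightarrow> d i \<ge> 0" "i \<in> {1..n}"
  shows "influence e d i \<ge> 0"
proof -
  have "e \<subseteq> {1..n}" by (rule edgeE[OF assms(1)]) auto
  then show ?thesis
    unfolding influence_def using assms(2,3)
    by (auto intro!: add_nonneg_nonneg sum_nonneg mult_nonneg_nonneg)
qed

text \<open>If \<open>i\<close> lies in \<open>e\<close>, the move erases the difference between
  \<open>x\<close> and \<open>y\<close>. Otherwise one passes from \<open>x\<close> to
  \<open>y\<close> in three steps: first the colours available at \<open>j\<close> change
  (\<open>c1\<close>), then those at \<open>k\<close> (\<open>c2\<close>), and last the colour of
  \<open>i\<close> seen by \<open>f\<close> (\<open>c3\<close>).\<close>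

lemma oscillation_heat_bath:
  assumes e: "e \<in> E" and f: "oscillation n q f d" and d: "\<And>i. i \<in> {1..n} \<Longrightarrow> d i \<ge> 0"
  shows "oscillation n q (\<lambda>x. measure_pmf.expectation (heat_bath n E q e x) f) (influence e d)"
  unfolding oscillation_def
proof (intro ballI impI)
  fix i x y assume i: "i \<in> {1..n}" and x: "x \<in> Conf" and y: "y \<in> Conf"
    and eq: "\<forall>v. v \<noteq> i \<longrightarrow> x v = y v"
  have xy: "x v = y v" if "v \<noteq> i" for v
    using eq that by simp
  obtain j k where jk: "e = {j, k}" "j \<noteq> k" "j \<in> {1..n}" "k \<in> {1..n}"
    by (rule edgeE[OF e])
  have E: "{j, k} \<in> E" "{k, j} \<in> E" using e jk by (auto simp: insert_commute)
  let ?F = "\<lambda>a b. f (x(j := a, k := b))" and ?G = "\<lambda>a b. f (y(j := a, k := b))"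
  let ?A = "avail E q x j k" and ?A' = "avail E q y j k"
  let ?B = "avail E q x k j" and ?B' = "avail E q y k j"
  have sub: "?A \<subseteq> {1..q}" "?A' \<subseteq> {1..q}" "?B \<subseteq> {1..q}" "?B' \<subseteq> {1..q}"
    by (auto simp: avail_def)
  have fin: "finite ?A'" "finite ?B'" "finite ?A" "finite ?B" by (auto simp: avail_def)
  have upd: "z(j := a, k := b) \<in> Conf" if "z \<in> Conf" "a \<in> {1..q}" "b \<in> {1..q}" for z a b
    by (intro configurations_upd that jk)
  have osc1: "\<bar>?F a b - ?F a' b\<bar> \<le> d j" if "a \<in> {1..q}" "a' \<in> {1..q}" "b \<in> {1..q}" for a a' b
    by (rule oscillationD[OF f jk(3) upd upd]) (use x that in simp_all)
  have osc2: "\<bar>?F a b - ?F a b'\<bar> \<le> d k" if "a \<in> {1..q}" "b \<in> {1..q}" "b' \<in> {1..q}" for a b b'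
    by (rule oscillationD[OF f jk(4) upd upd]) (use x that in simp_all)
  show "\<bar>measure_pmf.expectation (heat_bath n E q e x) f
      - measure_pmf.expectation (heat_bath n E q e y) f\<bar> \<le> influence e d i"
  proof (cases "i \<in> e")
    case True
    then have ijk: "i = j \<or> i = k" using jk(1) by simp
    have "x(j := a, k := b) = y(j := a, k := b)" for a b
    proof
      show "(x(j := a, k := b)) v = (y(j := a, k := b)) v" for v
        using ijk xy[of v] by (cases "v = j"; cases "v = k") auto
    qed
    moreover have far: "{i, j} \<notin> E \<or> i = k" "{i, k} \<notin> E \<or> i = j"
      using ijk edgeD(1)[of i i] by auto
    have "?A = ?A'" "?B = ?B'"
      using avail_cong[of i x y, OF xy far(1)] avail_cong[of i x y, OF xy far(2)] by simp_all
    ultimately have "measure_pmf.expectation (heat_bath n E q {j, k} x) f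
        = measure_pmf.expectation (heat_bath n E q {j, k} y) f"
      by (simp only: expectation_heat_bath_pair_avg[OF E(1)] x y)
    then show ?thesis
      using True by (simp add: jk(1) influence_def)
  next
    case False
    have c1: "\<bar>pair_avg ?F ?A ?B - pair_avg ?F ?A' ?B\<bar>
        \<le> of_bool ({i, j} \<in> E) * (d j / real s + d k / real s ^ 2)"
    proof (cases "{i, j} \<in> E")
      case True
      interpret two_spin ?F "{1..q}" ?B "d j" "d k"
        by unfold_locales (assumption | rule finite_atLeastAtMost sub osc1 osc2 d[OF jk(3)] d[OF jk(4)])+
      have "\<bar>pair_avg ?F ?A ?B - pair_avg ?F ?A' ?B\<bar> \<le> d j / real s + d k / real s ^ 2"
        by (intro avg_perturb s_ge sub card_avail[OF E(2)] card_avail_Int[OF E(1) xy]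
            card_avail_Diff[OF xy] card_avail_Diff[OF xy[symmetric]])
      then show ?thesis using True by simp
    next
      case F: False
      then have "?A = ?A'" by (intro avail_cong[OF xy]) auto
      then show ?thesis by (simp only: F) simp
    qed
    have c2: "\<bar>pair_avg ?F ?A' ?B - pair_avg ?F ?A' ?B'\<bar>
        \<le> of_bool ({i, k} \<in> E) * (d k / real s + d j / real s ^ 2)"
    proof (cases "{i, k} \<in> E")
      case True
      \<comment> \<open>Now the second set varies, so the endpoints exchange roles;
        \<open>pair_avg_commute\<close> translates back.\<close>
      interpret two_spin "\<lambda>b a. ?F a b" "{1..q}" ?A' "d k" "d j"
        by unfold_locales (assumption | rule finite_atLeastAtMost sub osc1 osc2 d[OF jk(3)] d[OF jk(4)])+
      have "\<bar>pair_avg (\<lambda>b a. ?F a b) ?B ?A' - pair_avg (\<lambda>b a. ?F a b) ?B' ?A'\<bar>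
          \<le> d k / real s + d j / real s ^ 2"
        by (intro avg_perturb s_ge sub card_avail[OF E(1)] card_avail_Int[OF E(2) xy]
            card_avail_Diff[OF xy] card_avail_Diff[OF xy[symmetric]])
      then show ?thesis using True fin by (simp add: pair_avg_commute[of ?A'])
    next
      case F: False
      then have "?B = ?B'" by (intro avail_cong[OF xy]) auto
      then show ?thesis by (simp only: F) simp
    qed
    have c3: "\<bar>pair_avg ?F ?A' ?B' - pair_avg ?G ?A' ?B'\<bar> \<le> d i"
    proof (rule pair_avg_diff)
      fix a b assume ab: "a \<in> ?A'" "b \<in> ?B'"
      show "\<bar>?F a b - ?G a b\<bar> \<le> d i"
        by (rule oscillationD[OF f i upd upd]) (use ab sub x y xy in \<open>simp_all add: subset_iff\<close>)
    qed (use fin d i in auto)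
    show ?thesis
      using c1 c2 c3 False jk(2)
      by (simp add: jk(1) expectation_heat_bath_pair_avg[OF E(1)] x y influence_pair)
  qed
qed

section \<open>Contraction of a scan\<close>

lemma \<alpha>_nonneg: "\<alpha> \<ge> 0"
  using \<Delta> by (simp add: \<alpha>_def)

lemma \<alpha>_le: "\<alpha> \<le> 1 - 1 / real \<Delta> ^ 2"
proof -
  let ?D = "real \<Delta>"
  have D: "?D \<ge> 1" "?D \<le> real s" using \<Delta> s_ge by auto
  have "1 / real s \<le> 1 / ?D" "1 / real s ^ 2 \<le> 1 / ?D ^ 2"
    using D by (auto intro!: divide_left_mono power_mono)
  then have "\<alpha> \<le> (?D - 1) * (1 / ?D + 1 / ?D ^ 2)"
    unfolding \<alpha>_def using D by (intro mult_left_mono add_mono) auto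
  also have "\<dots> = 1 - 1 / ?D ^ 2"
    using D by (simp add: field_simps power2_eq_square)
  finally show ?thesis .
qed

lemma \<alpha>_le_1: "\<alpha> \<le> 1"
  using \<alpha>_le by (smt (verit) divide_nonneg_nonneg zero_le_power of_nat_0_le_iff)

lemma card_nbrs_outside:
  assumes "{j, k} \<in> E"
  shows "(\<Sum>i\<in>{1..n} - {j, k}. of_bool ({i, j} \<in> E)) \<le> real \<Delta> - 1"
proof -
  have "({1..n} - {j, k}) \<inter> {i. {i, j} \<in> E} \<subseteq> nbrs E j - {k}"
    by (auto simp: nbrs_def insert_commute)
  then have "card (({1..n} - {j, k}) \<inter> {i. {i, j} \<in> E}) \<le> card (nbrs E j - {k})"
    using finite_nbrs by (intro card_mono) auto
  then have "(\<Sum>i\<in>{1..n} - {j, k}. of_bool ({i, j} \<in> E)) \<le> real (card (nbrs E j - {k}))"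
    by (simp add: sum_of_bool_eq)
  also have "\<dots> \<le> real \<Delta> - 1" using card_nbrs[OF assms] \<Delta> by linarith
  finally show ?thesis .
qed

text \<open>Dually, a move acts on weights: it resets those on \<open>e\<close> to \<alpha> and
  keeps the others. Indeed \<open>d j\<close> enters with \<open>1/s\<close> at the neighbours of
  \<open>j\<close> outside \<open>e\<close> and with \<open>1/s^2\<close> at those of
  \<open>k\<close>, at most \<open>\<Delta> - 1\<close> sites each, all of weight at most 1;
  likewise for \<open>d k\<close>.\<close>

lemma influence_weighted:
  assumes e: "e \<in> E" and d: "\<And>i. i \<in> {1..n} \<Longrightarrow> d i \<ge> 0"
    and w: "\<And>i. i \<in> {1..n} \<Longrightarrow> 0 \<le> w i \<and> w i \<le> 1"
  shows "(\<Sum>i\<in>{1..n}. w i * influence e d i) \<le> (\<Sum>i\<in>{1..n}. (if i \<in> e then \<alpha> else w i) * d i)"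
proof -
  obtain j k where jk: "e = {j, k}" "j \<noteq> k" "j \<in> {1..n}" "k \<in> {1..n}"
    by (rule edgeE[OF e])
  have E: "{j, k} \<in> E" "{k, j} \<in> E" using e jk by (auto simp: insert_commute)
  let ?V = "{1..n} - {j, k}"
  have sub: "{j, k} \<subseteq> {1..n}" using jk by auto
  have split: "(\<Sum>i\<in>{1..n}. g i) = g j + g k + (\<Sum>i\<in>?V. g i)" for g :: "nat \<Rightarrow> real"
    using sum.subset_diff[OF sub, of g] jk(2) by simp
  define aj where "aj i = (of_bool ({i, j} \<in> E) :: real)" for i
  define ak where "ak i = (of_bool ({i, k} \<in> E) :: real)" for i
  define p where "p = d j / real s + d k / real s ^ 2"
  define r where "r = d k / real s + d j / real s ^ 2"
  have p0: "p \<ge> 0" "r \<ge> 0" using d jk by (auto simp: p_def r_def)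
  have "(\<Sum>i\<in>{1..n}. w i * influence e d i) = (\<Sum>i\<in>?V. w i * influence e d i)"
    by (subst split) (simp add: influence_def jk(1))
  also have "\<dots> \<le> (\<Sum>i\<in>?V. w i * d i + aj i * p + ak i * r)"
  proof (rule sum_mono)
    fix i assume i: "i \<in> ?V"
    have inf: "influence e d i = d i + aj i * p + ak i * r"
      using i influence_pair[OF jk(2), of i d] by (simp add: jk(1) aj_def ak_def p_def r_def)
    have "w i * (aj i * p + ak i * r) \<le> 1 * (aj i * p + ak i * r)"
      using w[of i] i p0 by (intro mult_right_mono) (auto simp: aj_def ak_def)
    then show "w i * influence e d i \<le> w i * d i + aj i * p + ak i * r"
      unfolding inf by (simp add: algebra_simps)
  qed
  also have "\<dots> = (\<Sum>i\<in>?V. w i * d i) + (\<Sum>i\<in>?V. aj i) * p + (\<Sum>i\<in>?V. ak i) * r"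
    by (simp add: sum.distrib sum_distrib_right)
  also have "\<dots> \<le> (\<Sum>i\<in>?V. w i * d i) + (real \<Delta> - 1) * p + (real \<Delta> - 1) * r"
    using card_nbrs_outside[OF E(1)] card_nbrs_outside[OF E(2)] p0
    by (intro add_mono mult_right_mono order_refl) (auto simp: aj_def ak_def insert_commute)
  also have "\<dots> = \<alpha> * d j + \<alpha> * d k + (\<Sum>i\<in>?V. w i * d i)"
    by (simp add: \<alpha>_def p_def r_def algebra_simps)
  also have "(\<Sum>i\<in>?V. w i * d i) = (\<Sum>i\<in>?V. (if i \<in> e then \<alpha> else w i) * d i)"
    by (intro sum.cong) (auto simp: jk(1))
  also have "\<alpha> * d j + \<alpha> * d k + \<dots> = (\<Sum>i\<in>{1..n}. (if i \<in> e then \<alpha> else w i) * d i)"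
    by (subst split[of "\<lambda>i. (if i \<in> e then \<alpha> else w i) * d i"]) (simp add: jk(1))
  finally show ?thesis .
qed

section \<open>Composition of kernels on configurations\<close>

text \<open>Supports inside the finite set \<open>Conf\<close> turn expectations into finite sums,
  so that iterating them raises no question of integrability.\<close>

definition conf_kernel :: "((nat \<Rightarrow> nat) \<Rightarrow> (nat \<Rightarrow> nat) pmf) \<Rightarrow> bool" where
  "conf_kernel K \<longleftrightarrow> (\<forall>x\<in>Conf. set_pmf (K x) \<subseteq> Conf)"

lemma expectation_kernel_comp:
  fixes f :: "(nat \<Rightarrow> nat) \<Rightarrow> real"
  assumes "conf_kernel K" "conf_kernel L" "x \<in> Conf"
  shows "measure_pmf.expectation (kernel_comp K L x) f
    = measure_pmf.expectation (K x) (\<lambda>y. measure_pmf.expectation (L y) f)"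
proof -
  have K: "set_pmf (K x) \<subseteq> Conf"
    using assms(1,3) by (simp add: conf_kernel_def)
  have L: "finite (set_pmf (L y))" if "y \<in> Conf" for y
    by (rule finite_subset[OF _ finite_configurations[of n q]]) (use assms(2) that in \<open>simp add: conf_kernel_def\<close>)
  have "measure_pmf.expectation (kernel_comp K L x) f
      = (\<Sum>y\<in>Conf. pmf (K x) y *\<^sub>R measure_pmf.expectation (L y) f)"
    unfolding kernel_comp_def by (rule pmf_expectation_bind[OF finite_configurations]) (use K L in auto)
  also have "\<dots> = measure_pmf.expectation (K x) (\<lambda>y. measure_pmf.expectation (L y) f)"
    by (rule integral_measure_pmf[OF finite_configurations, symmetric]) (use K in auto)
  finally show ?thesis .
qed

lemma conf_kernel_kernel_comp: "conf_kernel K \<Longrightarrow> conf_kernel L \<Longrightarrow> conf_kernel (kernel_comp K L)"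
  by (auto simp: conf_kernel_def kernel_comp_def)

lemma conf_kernel_return: "conf_kernel return_pmf"
  by (auto simp: conf_kernel_def)

lemma conf_kernel_kernel_prod: "(\<And>K. K \<in> set Ks \<Longrightarrow> conf_kernel K) \<Longrightarrow> conf_kernel (kernel_prod Ks)"
  by (induction Ks) (auto simp: kernel_prod_def conf_kernel_return intro: conf_kernel_kernel_comp)

lemma conf_kernel_heat_bath: "e \<in> E \<Longrightarrow> conf_kernel (heat_bath n E q e)"
  using heat_bath_choices_finite heat_bath_choices_nonempty
  by (auto simp: conf_kernel_def heat_bath_def heat_bath_choices_def)

lemma conf_kernel_edge_scan: "set \<Theta> \<subseteq> E \<Longrightarrow> conf_kernel (edge_scan n E q \<Theta>)"
  unfolding edge_scan_def by (intro conf_kernel_kernel_prod) (auto intro: conf_kernel_heat_bath)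

lemma conf_kernel_kernel_power: "conf_kernel K \<Longrightarrow> conf_kernel (kernel_power K t)"
  unfolding kernel_power_def by (intro conf_kernel_kernel_prod) auto

lemma kernel_power_Suc: "kernel_power K (Suc t) = kernel_comp K (kernel_power K t)"
  by (simp add: kernel_power_def kernel_prod_def)

lemma edge_scan_Cons: "edge_scan n E q (e # \<Theta>) = kernel_comp (heat_bath n E q e) (edge_scan n E q \<Theta>)"
  by (simp add: edge_scan_def kernel_prod_def)

lemma foldr_influence_nonneg:
  assumes "set \<Theta> \<subseteq> E" and d: "\<And>i. i \<in> {1..n} \<Longrightarrow> d i \<ge> 0" and "i \<in> {1..n}"
  shows "foldr influence \<Theta> d i \<ge> 0"
  using assms(1,3)
proof (induction \<Theta> arbitrary: i)
  case Nil
  then show ?case using d by simp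
next
  case (Cons e \<Theta>)
  then have "influence e (foldr influence \<Theta> d) i \<ge> 0"
    by (intro influence_nonneg) auto
  then show ?case by simp
qed

text \<open>Conditioning on the first move makes its edge the outermost operator: a test function
  meets the moves in reverse order, hence \<open>foldr\<close>.\<close>

lemma oscillation_edge_scan:
  assumes "set \<Theta> \<subseteq> E" and f: "oscillation n q f d" and d: "\<And>i. i \<in> {1..n} \<Longrightarrow> d i \<ge> 0"
  shows "oscillation n q (\<lambda>x. measure_pmf.expectation (edge_scan n E q \<Theta> x) f) (foldr influence \<Theta> d)"
  using assms(1)
proof (induction \<Theta>)
  case Nil
  show ?case using f by (simp add: edge_scan_def kernel_prod_def)
next
  case (Cons e \<Theta>)
  then have e: "e \<in> E" and sub: "set \<Theta> \<subseteq> E"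
    and IH: "oscillation n q (\<lambda>x. measure_pmf.expectation (edge_scan n E q \<Theta> x) f) (foldr influence \<Theta> d)"
    by auto
  have "measure_pmf.expectation (edge_scan n E q (e # \<Theta>) x) f
      = measure_pmf.expectation (heat_bath n E q e x) (\<lambda>x. measure_pmf.expectation (edge_scan n E q \<Theta> x) f)"
    if "x \<in> Conf" for x
    unfolding edge_scan_Cons
    by (intro expectation_kernel_comp conf_kernel_heat_bath conf_kernel_edge_scan e sub that)
  then have "oscillation n q (\<lambda>x. measure_pmf.expectation (edge_scan n E q (e # \<Theta>) x) f)
        (influence e (foldr influence \<Theta> d))
      \<longleftrightarrow> oscillation n q (\<lambda>x. measure_pmf.expectation (heat_bath n E q e x)
        (\<lambda>x. measure_pmf.expectation (edge_scan n E q \<Theta> x) f)) (influence e (foldr influence \<Theta> d))"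
    by (rule oscillation_cong)
  then show ?case
    using oscillation_heat_bath[OF e IH foldr_influence_nonneg[OF sub d]] by simp
qed

text \<open>While \<open>d\<close> is transformed from the last edge backwards, the weights are
  transformed in scan order. A covered site has weight \<alpha> from then on, as a later edge can
  only reset it to \<alpha>; \<open>\<alpha> \<le> 1\<close> keeps the weights admissible. Tracking
  weights thus accumulates the gain at each site over the whole scan.\<close>

lemma foldr_influence_weighted:
  assumes "set \<Theta> \<subseteq> E" and d: "\<And>i. i \<in> {1..n} \<Longrightarrow> d i \<ge> 0"
    and w: "\<And>i. i \<in> {1..n} \<Longrightarrow> 0 \<le> w i \<and> w i \<le> 1"
  shows "(\<Sum>i\<in>{1..n}. w i * foldr influence \<Theta> d i)
    \<le> (\<Sum>i\<in>{1..n}. (if i \<in> \<Union>(set \<Theta>) then \<alpha> else w i) * d i)"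
  using assms(1) w
proof (induction \<Theta> arbitrary: w)
  case Nil
  show ?case by simp
next
  case (Cons e \<Theta>)
  let ?w = "\<lambda>i. if i \<in> e then \<alpha> else w i"
  have e: "e \<in> E" and sub: "set \<Theta> \<subseteq> E" using Cons by auto
  note nonneg = foldr_influence_nonneg[OF sub d]
  have w': "0 \<le> ?w i \<and> ?w i \<le> 1" if "i \<in> {1..n}" for i
    using Cons.prems(2)[OF that] \<alpha>_nonneg \<alpha>_le_1 by simp
  have "(\<Sum>i\<in>{1..n}. w i * foldr influence (e # \<Theta>) d i) \<le> (\<Sum>i\<in>{1..n}. ?w i * foldr influence \<Theta> d i)"
    using influence_weighted[OF e nonneg Cons.prems(2)] by simp
  also have "\<dots> \<le> (\<Sum>i\<in>{1..n}. (if i \<in> \<Union>(set \<Theta>) then \<alpha> else ?w i) * d i)"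
    by (rule Cons.IH[OF sub w'])
  also have "\<dots> = (\<Sum>i\<in>{1..n}. (if i \<in> \<Union>(set (e # \<Theta>)) then \<alpha> else w i) * d i)"
    by (intro sum.cong) auto
  finally show ?case .
qed

lemma edge_scan_power_oscillation:
  assumes \<Theta>: "set \<Theta> \<subseteq> E" "\<Union>(set \<Theta>) = {1..n}"
    and f: "oscillation n q f d" and d: "\<And>i. i \<in> {1..n} \<Longrightarrow> d i \<ge> 0"
  shows "\<exists>d'. oscillation n q (\<lambda>x. measure_pmf.expectation (kernel_power (edge_scan n E q \<Theta>) t x) f) d'
    \<and> (\<forall>i\<in>{1..n}. d' i \<ge> 0) \<and> sum d' {1..n} \<le> \<alpha> ^ t * sum d {1..n}"
proof (induction t)
  case 0
  show ?case using f d by (intro exI[of _ d]) (simp add: kernel_power_def kernel_prod_def)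
next
  case (Suc t)
  let ?K = "edge_scan n E q \<Theta>"
  let ?g = "\<lambda>x. measure_pmf.expectation (kernel_power ?K t x) f"
  obtain d' where d': "oscillation n q ?g d'" "\<And>i. i \<in> {1..n} \<Longrightarrow> d' i \<ge> 0"
    "sum d' {1..n} \<le> \<alpha> ^ t * sum d {1..n}"
    using Suc by blast
  let ?d = "foldr influence \<Theta> d'"
  have "measure_pmf.expectation (kernel_power ?K (Suc t) x) f = measure_pmf.expectation (?K x) ?g"
    if "x \<in> Conf" for x
    unfolding kernel_power_Suc
    by (intro expectation_kernel_comp conf_kernel_kernel_power conf_kernel_edge_scan \<Theta> that)
  then have "oscillation n q (\<lambda>x. measure_pmf.expectation (kernel_power ?K (Suc t) x) f) ?d
      \<longleftrightarrow> oscillation n q (\<lambda>x. measure_pmf.expectation (?K x) ?g) ?d"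
    by (rule oscillation_cong)
  then have "oscillation n q (\<lambda>x. measure_pmf.expectation (kernel_power ?K (Suc t) x) f) ?d"
    using oscillation_edge_scan[OF \<Theta>(1) d'(1,2)] by simp
  moreover have "\<forall>i\<in>{1..n}. ?d i \<ge> 0"
    using foldr_influence_nonneg[OF \<Theta>(1) d'(2)] by simp
  moreover have "sum ?d {1..n} \<le> \<alpha> ^ Suc t * sum d {1..n}"
  proof -
    \<comment> \<open>The weights start at 1, and as the scan covers all sites, they all end at
      \<alpha>.\<close>
    have "sum ?d {1..n} \<le> (\<Sum>i\<in>{1..n}. \<alpha> * d' i)"
      using foldr_influence_weighted[OF \<Theta>(1) d'(2), where w = "\<lambda>_. 1"] by (simp add: \<Theta>(2))
    also have "\<dots> = \<alpha> * sum d' {1..n}" by (simp add: sum_distrib_left)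
    also have "\<dots> \<le> \<alpha> * (\<alpha> ^ t * sum d {1..n})"
      using d'(3) \<alpha>_nonneg by (intro mult_left_mono)
    finally show ?thesis by simp
  qed
  ultimately show ?case by blast
qed

section \<open>Invariance of the uniform distribution\<close>

text \<open>Invariance of the uniform distribution on \<open>Col\<close>, tested against functions
  and multiplied by \<open>card Col\<close>.\<close>

definition uniform_invariant :: "((nat \<Rightarrow> nat) \<Rightarrow> (nat \<Rightarrow> nat) pmf) \<Rightarrow> bool" where
  "uniform_invariant K \<longleftrightarrow> (\<forall>f :: (nat \<Rightarrow> nat) \<Rightarrow> real.
     (\<Sum>x\<in>Col. measure_pmf.expectation (K x) f) = (\<Sum>x\<in>Col. f x))"

lemma Col_subset: "Col \<subseteq> Conf"
  by (auto simp: proper_colourings_def)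

lemma finite_Col: "finite Col"
  using Col_subset finite_configurations finite_subset by blast

lemma uniform_invariant_kernel_comp:
  assumes "uniform_invariant K" "uniform_invariant L" "conf_kernel K" "conf_kernel L"
  shows "uniform_invariant (kernel_comp K L)"
  unfolding uniform_invariant_def
proof
  fix f :: "(nat \<Rightarrow> nat) \<Rightarrow> real"
  have "(\<Sum>x\<in>Col. measure_pmf.expectation (kernel_comp K L x) f)
      = (\<Sum>x\<in>Col. measure_pmf.expectation (K x) (\<lambda>y. measure_pmf.expectation (L y) f))"
    using Col_subset by (intro sum.cong refl expectation_kernel_comp assms) auto
  then show "(\<Sum>x\<in>Col. measure_pmf.expectation (kernel_comp K L x) f) = (\<Sum>x\<in>Col. f x)"
    using assms(1,2) by (simp add: uniform_invariant_def)
qed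

lemma uniform_invariant_kernel_prod:
  "(\<And>K. K \<in> set Ks \<Longrightarrow> conf_kernel K \<and> uniform_invariant K) \<Longrightarrow> uniform_invariant (kernel_prod Ks)"
proof (induction Ks)
  case Nil
  show ?case by (simp add: kernel_prod_def uniform_invariant_def)
next
  case (Cons K Ks)
  have "uniform_invariant (kernel_comp K (kernel_prod Ks))"
    using Cons by (intro uniform_invariant_kernel_comp conf_kernel_kernel_prod) auto
  then show ?case by (simp add: kernel_prod_def)
qed

text \<open>An edge disjoint from \<open>e\<close> has both ends where \<open>y\<close> copies
  \<open>x\<close>, so it inherits its two colours from the proper colouring
  \<open>x\<close>.\<close>

lemma heat_bath_choices_Col:
  assumes "e \<in> E" "x \<in> Col"
  shows "heat_bath_choices n E q e x = {y \<in> Col. \<forall>i\<in>{1..n} - e. y i = x i}"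
proof (intro equalityI subsetI)
  fix y assume y: "y \<in> heat_bath_choices n E q e x"
  have "\<not> monochromatic y f" if f: "f \<in> E" for f
  proof (cases "f \<inter> e = {}")
    case True
    have "f \<subseteq> {1..n}" using f simple by (auto simp: simple_graph_def)
    then have "y v = x v" if "v \<in> f" for v
      using y True that by (auto simp: heat_bath_choices_def)
    then show ?thesis
      using assms(2) f by (simp add: monochromatic_def proper_colourings_def)
  qed (use y f in \<open>auto simp: heat_bath_choices_def\<close>)
  then show "y \<in> {y \<in> Col. \<forall>i\<in>{1..n} - e. y i = x i}"
    using y by (auto simp: heat_bath_choices_def proper_colourings_def)
qed (auto simp: heat_bath_choices_def proper_colourings_def)

text \<open>Agreement off \<open>e\<close> is an equivalence relation on \<open>Col\<close>, and the
  move draws uniformly from the class of \<open>x\<close>. After the sums are exchanged,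
  \<open>f y\<close> is counted once for each member of its class, each time divided by the size of
  that class.\<close>

lemma uniform_invariant_heat_bath:
  assumes e: "e \<in> E"
  shows "uniform_invariant (heat_bath n E q e)"
  unfolding uniform_invariant_def
proof
  fix f :: "(nat \<Rightarrow> nat) \<Rightarrow> real"
  define R where "R x y \<longleftrightarrow> (\<forall>i\<in>{1..n} - e. y i = x i)" for x y :: "nat \<Rightarrow> nat"
  let ?c = "\<lambda>x. {y \<in> Col. R x y}"
  have choices: "heat_bath_choices n E q e x = ?c x" if "x \<in> Col" for x
    using heat_bath_choices_Col[OF e that] by (simp add: R_def)
  have same: "?c x = ?c y" if "R x y" for x y
    using that by (auto simp: R_def)
  have "(\<Sum>x\<in>Col. measure_pmf.expectation (heat_bath n E q e x) f)
      = (\<Sum>x\<in>Col. \<Sum>y\<in>?c x. f y / card (?c x))"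
    using Col_subset
    by (intro sum.cong) (auto simp: expectation_heat_bath[OF e] choices sum_divide_distrib)
  also have "\<dots> = (\<Sum>y\<in>Col. \<Sum>x\<in>{x \<in> Col. R x y}. f y / card (?c x))"
    by (rule sum.swap_restrict[OF finite_Col finite_Col])
  also have "\<dots> = (\<Sum>y\<in>Col. f y)"
  proof (intro sum.cong refl)
    fix y assume y: "y \<in> Col"
    have eq: "{x \<in> Col. R x y} = ?c y" by (auto simp: R_def)
    have "y \<in> ?c y" using y by (simp add: R_def)
    then have pos: "card (?c y) > 0" using finite_Col card_gt_0_iff by fastforce
    have "(\<Sum>x\<in>{x \<in> Col. R x y}. f y / card (?c x)) = (\<Sum>x\<in>?c y. f y / card (?c y))"
      unfolding eq
    proof (intro sum.cong refl)
      fix x assume "x \<in> ?c y"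
      then have "R y x" by simp
      then show "f y / card (?c x) = f y / card (?c y)" by (simp only: same)
    qed
    also have "\<dots> = f y" using pos by simp
    finally show "(\<Sum>x\<in>{x \<in> Col. R x y}. f y / card (?c x)) = f y" .
  qed
  finally show "(\<Sum>x\<in>Col. measure_pmf.expectation (heat_bath n E q e x) f) = (\<Sum>x\<in>Col. f x)" .
qed

lemma uniform_invariant_edge_scan_power:
  assumes "set \<Theta> \<subseteq> E"
  shows "uniform_invariant (kernel_power (edge_scan n E q \<Theta>) t)"
proof -
  have "uniform_invariant (edge_scan n E q \<Theta>)"
    unfolding edge_scan_def using assms uniform_invariant_heat_bath conf_kernel_heat_bath
    by (intro uniform_invariant_kernel_prod) auto
  then show ?thesis
    unfolding kernel_power_def using conf_kernel_edge_scan[OF assms]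
    by (intro uniform_invariant_kernel_prod) auto
qed

text \<open>Permuting the colours shows that each of them is equally likely at \<open>i\<close>.\<close>

lemma card_Col_colour:
  assumes i: "i \<in> {1..n}" and c: "c \<in> {1..q}"
  shows "card Col \<le> q * card {y \<in> Col. y i = c}"
proof -
  have "card {y \<in> Col. y i = c'} \<le> card {y \<in> Col. y i = c}" if c': "c' \<in> {1..q}" for c'
  proof (rule card_inj_on_le)
    let ?\<tau> = "Transposition.transpose c c'"
    \<comment> \<open>Restricting keeps the recoloured map extensional, as configurations must
      be.\<close>
    let ?\<phi> = "\<lambda>y. restrict (?\<tau> \<circ> y) {1..n}"
    show "inj_on ?\<phi> {y \<in> Col. y i = c'}"
    proof (rule inj_onI)
      fix y z assume yz: "y \<in> {y \<in> Col. y i = c'}" "z \<in> {y \<in> Col. y i = c'}" and eq: "?\<phi> y = ?\<phi> z"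
      have "y v = z v" if "v \<in> {1..n}" for v
      proof -
        have "?\<tau> (y v) = ?\<tau> (z v)" using fun_cong[OF eq, of v] that by simp
        then show ?thesis by (metis transpose_involutory)
      qed
      then show "y = z"
        by (intro configurations_eqI[of y n q z]) (use yz Col_subset in auto)
    qed
    show "?\<phi> ` {y \<in> Col. y i = c'} \<subseteq> {y \<in> Col. y i = c}"
    proof (rule image_subsetI)
      fix y assume y: "y \<in> {y \<in> Col. y i = c'}"
      then have yC: "y \<in> Conf" using Col_subset by auto
      have "?\<tau> b \<in> {1..q}" if "b \<in> {1..q}" for b
        using that c c' by (auto simp: Transposition.transpose_def)
      then have "?\<phi> y \<in> Conf"
        using yC unfolding configurations_def by (auto simp: PiE_iff)
      moreover have "\<not> monochromatic (?\<phi> y) f" if f: "f \<in> E" for f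
      proof -
        obtain u v where uv: "f = {u, v}" "u \<in> {1..n}" "v \<in> {1..n}" using edgeE[OF f] by metis
        have "\<not> monochromatic y f" using y f by (auto simp: proper_colourings_def)
        then have "y u \<noteq> y v" using uv by (simp add: monochromatic_pair)
        then have "?\<tau> (y u) \<noteq> ?\<tau> (y v)" by (metis transpose_involutory)
        then show ?thesis using uv by (simp add: monochromatic_pair)
      qed
      moreover have "?\<phi> y i = c" using y i by simp
      ultimately show "?\<phi> y \<in> {y \<in> Col. y i = c}" by (simp add: proper_colourings_def)
    qed
  qed (use finite_Col in auto)
  moreover have "card Col = (\<Sum>c'\<in>{1..q}. card {y \<in> Col. y i = c'})"
  proof -
    have "Col = (\<Union>c'\<in>{1..q}. {y \<in> Col. y i = c'})"
      using Col_subset configurations_range i by blast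
    also have "card \<dots> = (\<Sum>c'\<in>{1..q}. card {y \<in> Col. y i = c'})"
      by (rule card_UN_disjoint) (use finite_Col in auto)
    finally show ?thesis .
  qed
  ultimately show ?thesis
    using sum_bounded_above[of "{1..q}" "\<lambda>c'. card {y \<in> Col. y i = c'}"] by simp
qed

section \<open>The mixing time\<close>

text \<open>The distance is a difference of expectations of one test function, whose oscillation
  shrinks to a sum of at most \<open>\<alpha>^t * n\<close> after \<open>t\<close> scans. Averaging
  over a uniform target colouring, rather than taking the worst one, gains the factor
  \<open>1 - 1/q\<close>.\<close>

lemma tv_dist_edge_scan_le:
  assumes \<Theta>: "set \<Theta> \<subseteq> E" "\<Union>(set \<Theta>) = {1..n}" and x: "x \<in> Col"
  shows "tv_dist Col (kernel_power (edge_scan n E q \<Theta>) t x) (pmf_of_set Col)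
    \<le> (1 - 1 / real q) * (\<alpha> ^ t * real n)"
proof -
  let ?P = "kernel_power (edge_scan n E q \<Theta>) t"
  let ?\<pi> = "pmf_of_set Col"
  \<comment> \<open>Half the sign of the difference realises the total variation distance. Its
    values lie in [-1/2, 1/2], so every site has oscillation at most 1; as it vanishes off
    \<open>Col\<close>, all expectations are sums over \<open>Col\<close>.\<close>
  define f where "f y = (if y \<in> Col then sgn (pmf (?P x) y - pmf ?\<pi> y) / 2 else 0)" for y
  define g where "g y = measure_pmf.expectation (?P y) f" for y
  have ne: "Col \<noteq> {}" using x by auto
  have f_exp: "measure_pmf.expectation M f = (\<Sum>y\<in>Col. f y * pmf M y)" for M
    by (rule integral_measure_pmf_real[OF finite_Col]) (simp add: f_def split: if_splits)
  have half: "\<bar>f y\<bar> \<le> 1 / 2" for y by (simp add: f_def sgn_if)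
  have "\<bar>f y - f z\<bar> \<le> 1" for y z
    using half[of y] half[of z] by linarith
  then have "oscillation n q f (\<lambda>_. 1)" by (simp add: oscillation_def)
  from edge_scan_power_oscillation[OF \<Theta> this, of t]
  obtain d where d: "oscillation n q g d" "\<And>i. i \<in> {1..n} \<Longrightarrow> d i \<ge> 0"
    "sum d {1..n} \<le> \<alpha> ^ t * real n"
    by (auto simp: g_def[abs_def])
  have q0: "real q > 0" using q \<Delta> by simp
  have "tv_dist Col (?P x) ?\<pi> = (\<Sum>y\<in>Col. f y * (pmf (?P x) y - pmf ?\<pi> y))"
    unfolding tv_dist_def sum_distrib_left
    by (intro sum.cong) (auto simp: f_def sgn_if abs_if)
  also have "\<dots> = g x - measure_pmf.expectation ?\<pi> f"
    by (simp add: g_def f_exp sum_subtractf algebra_simps)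
  \<comment> \<open>By invariance \<open>f\<close> may be replaced by \<open>g\<close> under the
    uniform distribution, so only differences \<open>g x - g y\<close> remain.\<close>
  also have "measure_pmf.expectation ?\<pi> f = (\<Sum>y\<in>Col. g y) / card Col"
    using uniform_invariant_edge_scan_power[OF \<Theta>(1), of t]
    by (simp add: integral_pmf_of_set[OF ne finite_Col] g_def uniform_invariant_def)
  also have "g x - \<dots> = (\<Sum>y\<in>Col. g x - g y) / card Col"
    using ne finite_Col by (simp add: sum_subtractf diff_divide_distrib)
  also have "\<dots> \<le> (\<Sum>y\<in>Col. \<Sum>i\<in>{1..n}. of_bool (x i \<noteq> y i) * d i) / card Col"
  proof (intro divide_right_mono sum_mono)
    fix y assume "y \<in> Col"
    then have "\<bar>g x - g y\<bar> \<le> (\<Sum>i\<in>{1..n}. of_bool (x i \<noteq> y i) * d i)"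
      using x Col_subset by (intro oscillation_telescope[OF d(1)]) auto
    then show "g x - g y \<le> (\<Sum>i\<in>{1..n}. of_bool (x i \<noteq> y i) * d i)" by linarith
  qed auto
  also have "\<dots> = (\<Sum>i\<in>{1..n}. (\<Sum>y\<in>Col. of_bool (x i \<noteq> y i)) / card Col * d i)"
    by (subst sum.swap) (simp add: sum_divide_distrib sum_distrib_right)
  \<comment> \<open>A uniform proper colouring takes the colour \<open>x i\<close> at site
    \<open>i\<close> with probability at least \<open>1/q\<close>, by
    \<open>card_Col_colour\<close>.\<close>
  also have "\<dots> \<le> (\<Sum>i\<in>{1..n}. (1 - 1 / real q) * d i)"
  proof (intro sum_mono mult_right_mono d(2))
    fix i assume i: "i \<in> {1..n}"
    have xi: "x i \<in> {1..q}" using configurations_range[of x n q i] x i Col_subset by auto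
    have le: "real (card Col) \<le> real q * real (card {y \<in> Col. y i = x i})"
      using of_nat_mono[OF card_Col_colour[OF i xi], where 'a = real] by simp
    have "(\<Sum>y\<in>Col. of_bool (x i \<noteq> y i)) = (\<Sum>y\<in>Col. 1 - of_bool (y i = x i) :: real)"
      by (intro sum.cong) auto
    also have "\<dots> = real (card Col) - real (card {y \<in> Col. y i = x i})"
      using finite_Col by (simp add: sum_subtractf of_bool_def sum.If_cases Int_def)
    finally have eq: "(\<Sum>y\<in>Col. of_bool (x i \<noteq> y i)) = real (card Col) - real (card {y \<in> Col. y i = x i})" .
    have "real (card Col) > 0" using ne finite_Col by (simp add: card_gt_0_iff)
    then show "(\<Sum>y\<in>Col. of_bool (x i \<noteq> y i)) / real (card Col) \<le> 1 - 1 / real q"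
      unfolding eq using le q0 by (simp add: field_simps)
  qed
  also have "\<dots> = (1 - 1 / real q) * sum d {1..n}"
    by (simp add: sum_distrib_left)
  also have "\<dots> \<le> (1 - 1 / real q) * (\<alpha> ^ t * real n)"
    using d(3) q \<Delta> by (intro mult_left_mono) auto
  finally show ?thesis .
qed

text \<open>The hypothesis \<open>t \<ge> 1\<close> matters at both ends: it makes
  \<open>\<alpha>^t\<close> vanish for \<open>\<Delta> = 1\<close>, and for
  \<open>q > 2 * \<Delta>\<close> it gives \<open>2 * t \<ge> t + 1\<close>, so that the bound on
  \<alpha> by a square suffices.\<close>

lemma contraction_with_start:
  assumes t: "t \<ge> 1"
  shows "(1 - 1 / real q) * \<alpha> ^ t \<le> (1 - 1 / real \<Delta> ^ 2) ^ Suc t"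
proof -
  let ?D = "real \<Delta>" and ?\<beta> = "1 - 1 / real \<Delta> ^ 2"
  have D: "?D \<ge> 1" using \<Delta> by simp
  have \<beta>: "0 \<le> ?\<beta>" "?\<beta> \<le> 1" using D by auto
  have q1: "real q \<ge> 1" using q \<Delta> by simp
  consider "\<Delta> = 1" | "\<Delta> \<ge> 2" "q = 2 * \<Delta>" | "\<Delta> \<ge> 2" "q \<ge> 2 * \<Delta> + 1"
    using \<Delta> q by linarith
  then show ?thesis
  proof cases
    case 1
    then have "\<alpha> = 0" unfolding \<alpha>_def by simp
    then show ?thesis using t zero_le_power[OF \<beta>(1), of "Suc t"] by (simp add: power_0_left)
  next
    case 2
    have "1 / ?D ^ 2 \<le> 1 / real q"
      using 2 by (simp add: field_simps power2_eq_square)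
    then have "(1 - 1 / real q) * \<alpha> ^ t \<le> ?\<beta> * ?\<beta> ^ t"
      using \<alpha>_le \<alpha>_nonneg q1 \<beta> by (intro mult_mono power_mono) auto
    then show ?thesis by simp
  next
    case 3
    have s: "real s \<ge> ?D + 1" using 3 by (simp add: s_def)
    have D2: "?D \<ge> 2" using 3 by simp
    have "1 / real s \<le> 1 / (?D + 1)" "1 / real s ^ 2 \<le> 1 / (?D + 1) ^ 2"
      using s D by (auto intro!: divide_left_mono power_mono)
    then have "\<alpha> \<le> (?D - 1) * (1 / (?D + 1) + 1 / (?D + 1) ^ 2)"
      unfolding \<alpha>_def using D by (intro mult_left_mono add_mono) auto
    also have "\<dots> = (?D - 1) * (?D + 2) / (?D + 1) ^ 2"
      using D by (simp add: divide_simps) (simp add: algebra_simps power2_eq_square)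
    also have "\<dots> \<le> ((?D - 1) * (?D + 1)) ^ 2 / (?D ^ 2) ^ 2"
    proof -
      \<comment> \<open>This is the inequality cross-multiplied, without the common factor
        \<open>?D - 1\<close>. The difference is grouped so that every summand is nonnegative for
        \<open>?D \<ge> 2\<close>.\<close>
      have "(?D - 1) * (?D + 1) ^ 4 - ?D ^ 4 * (?D + 2)
          = ?D ^ 4 + 2 * ?D ^ 2 * (?D - 2) + 2 * ?D * (?D - 2) + (?D - 1)"
        by (simp add: algebra_simps eval_nat_numeral)
      moreover have "\<dots> \<ge> 0" using D2 by simp
      ultimately have "?D ^ 4 * (?D + 2) \<le> (?D - 1) * (?D + 1) ^ 4" by linarith
      then have "(?D - 1) * (?D ^ 4 * (?D + 2)) \<le> (?D - 1) * ((?D - 1) * (?D + 1) ^ 4)"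
        using D by (intro mult_left_mono) auto
      moreover have "(?D - 1) * (?D ^ 4 * (?D + 2)) = (?D - 1) * (?D + 2) * (?D ^ 2) ^ 2"
        "(?D - 1) * ((?D - 1) * (?D + 1) ^ 4) = ((?D - 1) * (?D + 1)) ^ 2 * (?D + 1) ^ 2"
        by algebra+
      ultimately show ?thesis
        using D by (intro frac_le_cross) auto
    qed
    also have "\<dots> = ?\<beta> ^ 2"
      using D by (simp add: divide_simps) (simp add: algebra_simps power2_eq_square)
    finally have "\<alpha> ^ t \<le> (?\<beta> ^ 2) ^ t" using \<alpha>_nonneg by (intro power_mono)
    also have "\<dots> = ?\<beta> ^ (2 * t)" by (simp add: power_mult)
    also have "\<dots> \<le> ?\<beta> ^ Suc t" using t \<beta> by (intro power_decreasing) auto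
    finally have "\<alpha> ^ t \<le> ?\<beta> ^ Suc t" .
    moreover have "(1 - 1 / real q) * \<alpha> ^ t \<le> 1 * \<alpha> ^ t"
      using \<alpha>_nonneg q1 by (intro mult_right_mono) auto
    ultimately show ?thesis by linarith
  qed
qed

text \<open>With \<open>1 - u \<le> exp (- u)\<close> for \<open>u = 1 / \<Delta>^2\<close>, the
  \<open>t + 1\<close> factors multiply to at most \<open>\<epsilon> / n\<close>.\<close>

lemma tv_dist_edge_scan_le_eps:
  assumes \<Theta>: "set \<Theta> \<subseteq> E" "\<Union>(set \<Theta>) = {1..n}" and x: "x \<in> Col" and \<epsilon>: "\<epsilon> > 0" and n: "n \<ge> 1"
    and t: "t \<ge> 1" "real \<Delta> ^ 2 * ln (real n / \<epsilon>) \<le> real (Suc t)"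
  shows "tv_dist Col (kernel_power (edge_scan n E q \<Theta>) t x) (pmf_of_set Col) \<le> \<epsilon>"
proof -
  let ?D = "real \<Delta>"
  have D: "?D \<ge> 1" using \<Delta> by simp
  have "tv_dist Col (kernel_power (edge_scan n E q \<Theta>) t x) (pmf_of_set Col)
      \<le> (1 - 1 / real q) * \<alpha> ^ t * real n"
    using tv_dist_edge_scan_le[OF \<Theta> x, of t] by (simp add: mult.assoc)
  also have "\<dots> \<le> (1 - 1 / ?D ^ 2) ^ Suc t * real n"
    using contraction_with_start[OF t(1)] by (intro mult_right_mono) auto
  also have "\<dots> \<le> exp (- (1 / ?D ^ 2)) ^ Suc t * real n"
    using D exp_ge_add_one_self[of "- (1 / ?D ^ 2)"] by (intro mult_right_mono power_mono) auto
  also have "exp (- (1 / ?D ^ 2)) ^ Suc t = exp (- (real (Suc t) / ?D ^ 2))"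
    by (subst exp_of_nat_mult[symmetric]) simp
  also have "\<dots> \<le> exp (- ln (real n / \<epsilon>))"
    using t(2) D by (simp add: field_simps)
  also have "\<dots> = \<epsilon> / real n"
    using \<epsilon> n by (simp add: exp_minus)
  finally show ?thesis using n by (simp add: mult_right_mono)
qed

end

text \<open>\<open>mixing_time_from\<close> is at least 1 by definition, whereas
  \<open>\<Delta>^2 * ln (n / \<epsilon>)\<close> drops below 1 for \<open>\<Delta> = 1\<close>,
  \<open>n = 2\<close> and \<epsilon> close to 1; hence the maximum with 1.\<close>

theorem theorem3:
  fixes n q \<Delta> :: nat and E :: "nat set set" and \<Theta> :: "nat set list" and \<epsilon> :: real
  assumes "n \<ge> 1"
    and "simple_graph n E"
    and "\<Delta> = max_degree n E"
    and "distinct \<Theta>" and "set \<Theta> \<subseteq> E" and "\<Union>(set \<Theta>) = {1..n}"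
    and "q \<ge> 2 * \<Delta>"
    and "0 < \<epsilon>" and "\<epsilon> < 1"
  shows "ereal_of_enat
           (mixing_time (proper_colourings n E q) (edge_scan n E q \<Theta>)
              (pmf_of_set (proper_colourings n E q)) \<epsilon>)
         \<le> ereal (max 1 (real \<Delta> ^ 2 * ln (real n / \<epsilon>)))"
proof -
  have deg: "degree E v \<le> \<Delta>" if "v \<in> {1..n}" for v
    using that assms(3) by (simp add: max_degree_def)
  have "\<Delta> \<ge> 1"
  proof -
    \<comment> \<open>Since the edges cover site 1, some edge exists.\<close>
    have "1 \<in> \<Union>(set \<Theta>)" using assms(1,6) by simp
    then obtain e where "e \<in> E" "1 \<in> e" using assms(5) by auto
    moreover have "finite E"
      by (rule finite_subset[of _ "Pow {1..n}"]) (use assms(2) in \<open>auto simp: simple_graph_def\<close>)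
    ultimately have "degree E 1 > 0" by (auto simp: degree_def card_gt_0_iff)
    then show ?thesis using deg[of 1] assms(1) by simp
  qed
  then interpret scan_graph n q \<Delta> E
    using assms(2,7) deg by unfold_locales
  define T where "T = max 1 (real \<Delta> ^ 2 * ln (real n / \<epsilon>))"
  \<comment> \<open>Rounding down keeps \<open>t\<close> within the bound and costs less than one
    scan: \<open>T \<le> t + 1\<close> is just what \<open>tv_dist_edge_scan_le_eps\<close> asks
    for.\<close>
  define t where "t = nat \<lfloor>T\<rfloor>"
  have T1: "T \<ge> 1" by (simp add: T_def)
  have t: "t \<ge> 1" "real t \<le> T" "T \<le> real (Suc t)"
    using T1 by (auto simp: t_def le_nat_iff) linarith+
  have "mixing_time_from Col (edge_scan n E q \<Theta>) (pmf_of_set Col) x \<epsilon> \<le> enat t" if "x \<in> Col" for x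
    unfolding mixing_time_from_def
    using tv_dist_edge_scan_le_eps[OF assms(5,6) that assms(8,1) t(1)] t
    by (intro Inf_lower) (auto simp: T_def)
  then have "mixing_time Col (edge_scan n E q \<Theta>) (pmf_of_set Col) \<epsilon> \<le> enat t"
    unfolding mixing_time_def by (rule SUP_least)
  then have "ereal_of_enat (mixing_time Col (edge_scan n E q \<Theta>) (pmf_of_set Col) \<epsilon>) \<le> ereal_of_enat (enat t)"
    by (simp only: ereal_of_enat_le_iff)
  also have "\<dots> \<le> ereal T" using t by simp
  finally show ?thesis by (simp add: T_def)
qed

end
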